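(* Let $m,d,i\ge 0$ be integers and let $c^i_{m,d}$ be the coefficient of $t^i$ in the Kazhdan--Lusztig polynomial of the uniform matroid $U_{m,d}$ of rank $d$ on $m+d$ elements. Then $$c^i_{m,d}=\#\,SkYT(m+1,i,d-2i+1).$$
   Context: **Kazhdan--Lusztig polynomial of a matroid.** For a matroid $M$ with lattice of flats $L(M)$, the characteristic polynomial is $\chi_M(t)=\sum_{F\in L(M)}\mu(\hat 0,F)\,t^{\operatorname{rk}M-\operatorname{rk}F}$, where $\mu$ is the Möbius function of $L(M)$ and $\hat 0$ its minimum. For a flat $F$, the localization $M^F$ is the matroid with ground set $F$ whose independent sets are the subsets of $F$ independent in $M$; the contraction $M_F$ is the matroid on the complement of $F$ whose independent sets are the subsets whose union with a basis of $F$ is independent in $M$. The Kazhdan--Lusztig polynomial $P_M(t)\in\mathbb Z[t]$ is the unique assignment with: (1) if $\operatorname{rk}M=0$ then $P_M(t)=1$; (2) if $\operatorname{rk}M>0$ then $\deg P_M<\tfrac12\operatorname{rk}M$; (3) $t^{\operatorname{rk}M}P_M(t^{-1})=\sum_{F\text{ a flat}}\chi_{M^F}(t)P_{M_F}(t)$. **Skew tableaux.** For $i\ge 1$, $a,b\ge 2$ consider the skew shape with columns $1,\dots,i+1$ and rows $1,\dots,a+b-2$ (numbered top to bottom) having cells: rows $1,\dots,b-2$ contain only the cell in column $i+1$; rows $b-1$ and $b$ contain all columns $1,\dots,i+1$; rows $b+1,\dots,b+a-2$ contain only the cell in column $1$. So the left-most column has height $a$, it is followed by $i-1$ columns of height 2,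 then a right-most column of height $b$. A legal filling places each of $1,\dots,a+2i+b-2$ exactly once, with rows strictly increasing to the right and columns strictly increasing downward. $SkYT(a,i,b)$ is the set of legal fillings. Conventions: $\#SkYT(a,0,b)=1$; if $i>0$ and $a<2$ or $b<2$, then $\#SkYT(a,i,b)=0$. *)

theory Defs
  imports Main "HOL-Library.FuncSet" "HOL-Computational_Algebra.Polynomial"
begin

section \<open>Matroids on finite ground sets\<close>

definition is_matroid :: "'a set \<Rightarrow> 'a set set \<Rightarrow> bool" where
  "is_matroid E I \<longleftrightarrow>
     finite E \<and> I \<subseteq> Pow E \<and> {} \<in> I \<and>
     (\<forall>X\<in>I. \<forall>Y. Y \<subseteq> X \<longrightarrow> Y \<in> I) \<and>
     (\<forall>X\<in>I. \<forall>Y\<in>I. card X < card Y \<longrightarrow> (\<exists>e\<in>Y - X. insert e X \<in> I))"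

typedef 'a matroid = "{(E :: 'a set, I). is_matroid E I}"
  by (rule exI[of _ "({}, {{}})"]) (auto simp: is_matroid_def)

setup_lifting type_definition_matroid

lift_definition ground :: "'a matroid \<Rightarrow> 'a set" is fst .

lift_definition indep_sets :: "'a matroid \<Rightarrow> 'a set set" is snd .

lemma is_matroid_matroid: "is_matroid (ground M) (indep_sets M)"
  by transfer auto

definition basis_of :: "'a set set \<Rightarrow> 'a set \<Rightarrow> 'a set \<Rightarrow> bool" where
  "basis_of I F B \<longleftrightarrow> B \<in> I \<and> B \<subseteq> F \<and> (\<forall>C\<in>I. B \<subseteq> C \<and> C \<subseteq> F \<longrightarrow> C = B)"

definition rank_of :: "'a matroid \<Rightarrow> 'a set \<Rightarrow> nat" where
  "rank_of M X = Max (card ` {Y \<in> indep_sets M. Y \<subseteq> X})"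

definition rk :: "'a matroid \<Rightarrow> nat" where
  "rk M = rank_of M (ground M)"

definition flats :: "'a matroid \<Rightarrow> 'a set set" where
  "flats M = {F. F \<subseteq> ground M \<and> (\<forall>e\<in>ground M - F. rank_of M F < rank_of M (insert e F))}"

lemma is_matroidD:
  assumes "is_matroid E I"
  shows "finite E" "I \<subseteq> Pow E" "{} \<in> I"
    and "X \<in> I \<Longrightarrow> Y \<subseteq> X \<Longrightarrow> Y \<in> I"
  using assms by (auto simp: is_matroid_def)

lemma is_matroid_augment:
  assumes "is_matroid E I" "X \<in> I" "Y \<in> I" "card X < card Y"
  obtains e where "e \<in> Y" "e \<notin> X" "insert e X \<in> I"
proof -
  have "\<exists>e\<in>Y - X. insert e X \<in> I"
    using assms by (simp add: is_matroid_def)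
  then show thesis using that by blast
qed

lemma is_matroid_localization:
  assumes M: "is_matroid E I"
  shows "is_matroid (E \<inter> F) {X \<in> I. X \<subseteq> F}"
  unfolding is_matroid_def
proof (intro conjI ballI impI allI)
  fix X Y assume *: "X \<in> {X \<in> I. X \<subseteq> F}" "Y \<in> {X \<in> I. X \<subseteq> F}" "card X < card Y"
  then obtain e where "e \<in> Y" "e \<notin> X" "insert e X \<in> I"
    using is_matroid_augment[OF M, of X Y] by auto
  with * show "\<exists>e\<in>Y - X. insert e X \<in> {X \<in> I. X \<subseteq> F}"
    by (intro bexI[of _ e]) auto
next
  fix X Y assume "X \<in> {X \<in> I. X \<subseteq> F}" "Y \<subseteq> X"
  then show "Y \<in> {X \<in> I. X \<subseteq> F}" using is_matroidD(4)[OF M, of X Y] by auto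
qed (use is_matroidD(1-3)[OF M] in auto)

lemma is_matroid_card_basis:
  assumes "is_matroid E I" "basis_of I F B" "basis_of I F C"
  shows "card B = card C"
proof -
  have *: "\<not> card B < card C" if B: "basis_of I F B" and C: "basis_of I F C" for B C
  proof
    assume "card B < card C"
    then obtain e where e: "e \<in> C" "e \<notin> B" "insert e B \<in> I"
      using is_matroid_augment[OF assms(1), of B C] B C by (auto simp: basis_of_def)
    then have "insert e B \<subseteq> F" using B C by (auto simp: basis_of_def)
    then have "insert e B = B" using B e by (auto simp: basis_of_def)
    with e show False by blast
  qed
  from *[OF assms(2,3)] *[OF assms(3,2)] show ?thesis by simp
qed

lemma is_matroid_ex_basis:
  assumes "is_matroid E I"
  shows "\<exists>B. basis_of I F B"
proof -
  have "I \<subseteq> Pow E" "finite E" "{} \<in> I" using assms by (auto simp: is_matroid_def)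
  then have "finite {X \<in> I. X \<subseteq> F}" "{X \<in> I. X \<subseteq> F} \<noteq> {}"
    by (auto intro: finite_subset)
  from finite_has_maximal[OF this] obtain B where
    B: "B \<in> {X \<in> I. X \<subseteq> F}" "\<And>C. C \<in> {X \<in> I. X \<subseteq> F} \<Longrightarrow> B \<subseteq> C \<Longrightarrow> B = C"
    by auto
  have "basis_of I F B"
    unfolding basis_of_def using B(1) B(2)[symmetric] by simp
  then show ?thesis ..
qed

lemma is_matroid_contraction:
  assumes M: "is_matroid E I"
  shows "is_matroid (E - F) {X. X \<subseteq> E - F \<and> (\<exists>B. basis_of I F B \<and> X \<union> B \<in> I)}"
  unfolding is_matroid_def
proof (intro conjI ballI impI allI)
  show "finite (E - F)" using M by (simp add: is_matroid_def)
  show "{} \<in> {X. X \<subseteq> E - F \<and> (\<exists>B. basis_of I F B \<and> X \<union> B \<in> I)}"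
    using is_matroid_ex_basis[OF M, of F] by (auto simp: basis_of_def)
next
  fix X Y
  assume "X \<in> {X. X \<subseteq> E - F \<and> (\<exists>B. basis_of I F B \<and> X \<union> B \<in> I)}" "Y \<subseteq> X"
  then obtain B where B: "X \<subseteq> E - F" "basis_of I F B" "X \<union> B \<in> I" by blast
  moreover have "Y \<union> B \<subseteq> X \<union> B" using \<open>Y \<subseteq> X\<close> by blast
  ultimately have "Y \<union> B \<in> I" using M unfolding is_matroid_def by blast
  with B \<open>Y \<subseteq> X\<close> show "Y \<in> {X. X \<subseteq> E - F \<and> (\<exists>B. basis_of I F B \<and> X \<union> B \<in> I)}"
    by blast
next
  fix X Y
  assume "X \<in> {X. X \<subseteq> E - F \<and> (\<exists>B. basis_of I F B \<and> X \<union> B \<in> I)}"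
     and "Y \<in> {X. X \<subseteq> E - F \<and> (\<exists>B. basis_of I F B \<and> X \<union> B \<in> I)}"
     and less: "card X < card Y"
  then obtain B C where X: "X \<subseteq> E - F" "basis_of I F B" "X \<union> B \<in> I"
     and Y: "Y \<subseteq> E - F" "basis_of I F C" "Y \<union> C \<in> I" by blast
  have fin: "finite E" and sub: "I \<subseteq> Pow E" using M by (auto simp: is_matroid_def)
  have "B \<subseteq> F" "C \<subseteq> F" using X Y by (auto simp: basis_of_def)
  have "X \<inter> B = {}" "Y \<inter> C = {}" using X Y \<open>B \<subseteq> F\<close> \<open>C \<subseteq> F\<close> by auto
  moreover have "finite (X \<union> B)" "finite (Y \<union> C)"
    using X(3) Y(3) fin sub by (meson PowD finite_subset subsetD)+
  ultimately have "card (X \<union> B) < card (Y \<union> C)"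
    using less is_matroid_card_basis[OF M X(2) Y(2)] by (simp add: card_Un_disjoint)
  then obtain e where e: "e \<in> (Y \<union> C) - (X \<union> B)" "insert e (X \<union> B) \<in> I"
    using M X(3) Y(3) unfolding is_matroid_def by blast
  have "e \<notin> F"
  proof
    assume "e \<in> F"
    have "insert e B \<subseteq> insert e (X \<union> B)" by blast
    with e(2) have "insert e B \<in> I" using M unfolding is_matroid_def by blast
    with X(2) \<open>e \<in> F\<close> e(1) show False unfolding basis_of_def by blast
  qed
  with e Y(1) X \<open>C \<subseteq> F\<close>
  show "\<exists>e\<in>Y - X. insert e X \<in> {X. X \<subseteq> E - F \<and> (\<exists>B. basis_of I F B \<and> X \<union> B \<in> I)}"
    by (intro bexI[of _ e]) auto
qed auto

lift_definition localization :: "'a matroid \<Rightarrow> 'a set \<Rightarrow> 'a matroid"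
  is "\<lambda>(E, I) F. (E \<inter> F, {X \<in> I. X \<subseteq> F})"
  by (auto intro: is_matroid_localization)

lift_definition contraction :: "'a matroid \<Rightarrow> 'a set \<Rightarrow> 'a matroid"
  is "\<lambda>(E, I) F. (E - F, {X. X \<subseteq> E - F \<and> (\<exists>B. basis_of I F B \<and> X \<union> B \<in> I)})"
  by (auto intro: is_matroid_contraction)

lemma is_matroid_uniform:
  assumes "finite E"
  shows "is_matroid E {X. X \<subseteq> E \<and> card X \<le> d}"
  unfolding is_matroid_def
proof (intro conjI ballI impI allI)
  fix X Y assume *: "X \<in> {X. X \<subseteq> E \<and> card X \<le> d}" "Y \<subseteq> X"
  then have "card Y \<le> card X" using assms by (auto intro: card_mono finite_subset)
  with * show "Y \<in> {X. X \<subseteq> E \<and> card X \<le> d}" by auto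
next
  fix X Y assume *: "X \<in> {X. X \<subseteq> E \<and> card X \<le> d}" "Y \<in> {X. X \<subseteq> E \<and> card X \<le> d}"
    and less: "card X < card Y"
  have "finite X" "finite Y" using * assms by (auto intro: finite_subset)
  with less have "\<not> Y \<subseteq> X" using card_mono[of X Y] by auto
  then obtain e where "e \<in> Y - X" by blast
  with * less \<open>finite X\<close> show "\<exists>e\<in>Y - X. insert e X \<in> {X. X \<subseteq> E \<and> card X \<le> d}"
    by (intro bexI[of _ e]) auto
qed (use assms in auto)

lift_definition uniform_matroid :: "nat \<Rightarrow> nat \<Rightarrow> nat matroid"
  is "\<lambda>m d. ({1..m + d}, {X. X \<subseteq> {1..m + d} \<and> card X \<le> d})"
  by (auto intro: is_matroid_uniform)

section \<open>Characteristic and Kazhdan--Lusztig polynomials\<close>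

text \<open>The Moebius function of the finite poset \<open>L\<close> with the order induced by the type;
  finiteness of \<open>L\<close> only serves termination.\<close>

function mobius :: "'a::order set \<Rightarrow> 'a \<Rightarrow> 'a \<Rightarrow> int" where
  "mobius L x y =
     (if x = y then 1
      else if x < y \<and> finite L then - (\<Sum>z\<in>{z \<in> L. x \<le> z \<and> z < y}. mobius L x z)
      else 0)"
  by auto
termination
proof (relation "measure (\<lambda>(L, x, y). card {z \<in> L. z < y})")
  fix L :: "'a set" and x y z
  assume "x < y \<and> finite L" and z: "z \<in> {z \<in> L. x \<le> z \<and> z < y}"
  then have "finite {w \<in> L. w < y}" by simp
  moreover have "{w \<in> L. w < z} \<subset> {w \<in> L. w < y}" using z by auto
  ultimately show "((L, x, z), (L, x, y)) \<in> measure (\<lambda>(L, x, y). card {z \<in> L. z < y})"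
    by (simp add: psubset_card_mono)
qed simp

declare mobius.simps [simp del]

definition matroid_char_poly :: "'a matroid \<Rightarrow> int poly" where
  "matroid_char_poly M =
     (\<Sum>F\<in>flats M. monom (mobius (flats M) (LEAST F. F \<in> flats M) F) (rk M - rank_of M F))"

text \<open>\<open>t ^ n * p (1 / t)\<close>, as a polynomial, for \<open>degree p \<le> n\<close>; the degree condition holds
  wherever this is used below.\<close>

definition reverse_poly :: "nat \<Rightarrow> int poly \<Rightarrow> int poly" where
  "reverse_poly n p = monom 1 (n - degree p) * reflect_poly p"

definition kl_assignment :: "('a matroid \<Rightarrow> int poly) \<Rightarrow> bool" where
  "kl_assignment P \<longleftrightarrow>
     (\<forall>M. rk M = 0 \<longrightarrow> P M = 1) \<and>
     (\<forall>M. rk M > 0 \<longrightarrow> 2 * degree (P M) < rk M) \<and>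
     (\<forall>M. reverse_poly (rk M) (P M) =
          (\<Sum>F\<in>flats M. matroid_char_poly (localization M F) * P (contraction M F)))"

definition KL_poly :: "'a matroid \<Rightarrow> int poly" where
  "KL_poly = (THE P. kl_assignment P)"

section \<open>Skew tableaux\<close>

text \<open>A cell is a pair (row, column), both numbered from 1, rows from top to bottom.
  The shape is meant for \<open>i \<ge> 1\<close> and \<open>a, b \<ge> 2\<close>.\<close>

definition skew_cells :: "nat \<Rightarrow> nat \<Rightarrow> nat \<Rightarrow> (nat \<times> nat) set" where
  "skew_cells a i b =
     {1..b - 2} \<times> {i + 1} \<union> {b - 1, b} \<times> {1..i + 1} \<union> {b + 1..b + a - 2} \<times> {1}"

definition SkYT :: "nat \<Rightarrow> nat \<Rightarrow> nat \<Rightarrow> (nat \<times> nat \<Rightarrow> nat) set" where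
  "SkYT a i b =
     {f \<in> extensional (skew_cells a i b).
        bij_betw f (skew_cells a i b) {1..a + 2 * i + b - 2} \<and>
        (\<forall>r c c'. (r, c) \<in> skew_cells a i b \<longrightarrow> (r, c') \<in> skew_cells a i b \<longrightarrow> c < c' \<longrightarrow>
           f (r, c) < f (r, c')) \<and>
        (\<forall>r r' c. (r, c) \<in> skew_cells a i b \<longrightarrow> (r', c) \<in> skew_cells a i b \<longrightarrow> r < r' \<longrightarrow>
           f (r, c) < f (r', c))}"

text \<open>The number of skew tableaux with the conventions for degenerate parameters; \<open>a\<close> and
  \<open>b\<close> are integers since \<open>b\<close> may be negative.\<close>

definition num_SkYT :: "int \<Rightarrow> nat \<Rightarrow> int \<Rightarrow> nat" where
  "num_SkYT a i b =
     (if i = 0 then 1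
      else if a < 2 \<or> b < 2 then 0
      else card (SkYT (nat a) i (nat b)))"

end

theory Submission
  imports Defs Complex_Main
begin

text \<open>
  By Moebius inversion over the lattice of flats, the recursion with characteristic polynomials
  is equivalent to palindromicity of the Z-polynomials \<open>\<Sum>F. t ^ rk F * P (M / F)\<close> of all
  contractions. In this form existence is immediate: the coefficients of \<open>P\<close> below half the
  rank are exactly what is needed to make the other summands palindromic.

  For uniform matroids it remains to see that
  \<open>\<Sum>k. ((m + d) choose k) * c (d - k) (j - k)\<close> is invariant under \<open>j \<mapsto> d - j\<close>, where \<open>c d i\<close>
  counts tableaux. Removing the largest entry shows
  \<open>c d i = (m + d)! * (\<Sum>r\<in>{i<..d - i}. A r i / (d - i - r)!)\<close>, where, up to sign, \<open>A r i\<close> is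
  the number of standard Young tableaux of shape \<open>(r, i + 1, 1 ^ (m - 1))\<close> divided by the
  factorial of its size. As a function of all \<open>r\<close> and \<open>i\<close>, \<open>A\<close> is antisymmetric of the form
  \<open>\<phi> i * \<rho> r - \<phi> r * \<rho> i\<close>, with \<open>\<rho>\<close> the coefficients of \<open>exp (- z)\<close>. Hence the difference of the
  two sums to be compared factors completely, and it vanishes since
  \<open>exp z * exp (- z) = 1\<close>.
\<close>

section \<open>Rank and flats under localization and contraction\<close>

lemma finite_ground [simp]: "finite (ground M)"
  using is_matroid_matroid[of M] by (simp add: is_matroid_def)

lemma indep_subset_ground: "X \<in> indep_sets M \<Longrightarrow> X \<subseteq> ground M"
  using is_matroid_matroid[of M] by (auto simp: is_matroid_def)

lemma finite_indep: "X \<in> indep_sets M \<Longrightarrow> finite X"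
  using indep_subset_ground finite_ground finite_subset by metis

lemma empty_indep [simp]: "{} \<in> indep_sets M"
  using is_matroid_matroid[of M] by (simp add: is_matroid_def)

lemma indep_downward: "X \<in> indep_sets M \<Longrightarrow> Y \<subseteq> X \<Longrightarrow> Y \<in> indep_sets M"
  using is_matroidD(4)[OF is_matroid_matroid] .

lemma finite_indep_within: "finite {Y \<in> indep_sets M. Y \<subseteq> X}"
  by (rule finite_subset[of _ "Pow (ground M)"]) (auto dest: indep_subset_ground)

lemma card_indep_le_rank: "Y \<in> indep_sets M \<Longrightarrow> Y \<subseteq> X \<Longrightarrow> card Y \<le> rank_of M X"
  unfolding rank_of_def using finite_indep_within by (intro Max_ge) auto

lemma rank_witness:
  obtains Y where "Y \<in> indep_sets M" "Y \<subseteq> X" "card Y = rank_of M X"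
proof -
  have "rank_of M X \<in> card ` {Y \<in> indep_sets M. Y \<subseteq> X}"
    unfolding rank_of_def using finite_indep_within[of M X] empty_indep[of M]
    by (intro Max_in) blast+
  then show thesis using that by auto
qed

lemma rank_mono: "X \<subseteq> Y \<Longrightarrow> rank_of M X \<le> rank_of M Y"
  by (metis rank_witness card_indep_le_rank order_trans)

lemma rank_empty [simp]: "rank_of M {} = 0"
  by (metis rank_witness card.empty subset_empty)

lemma indep_extend:
  assumes "Y \<in> indep_sets M" "Y \<subseteq> X"
  obtains B where "B \<in> indep_sets M" "Y \<subseteq> B" "B \<subseteq> X" "card B = rank_of M X"
proof -
  have "\<exists>B\<in>indep_sets M. Y \<subseteq> B \<and> B \<subseteq> X \<and> card B = rank_of M X"
    using assms
  proof (induction "rank_of M X - card Y" arbitrary: Y rule: less_induct)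
    case less
    show ?case
    proof (cases "card Y = rank_of M X")
      case False
      obtain Z where Z: "Z \<in> indep_sets M" "Z \<subseteq> X" "card Z = rank_of M X"
        by (rule rank_witness)
      have lt: "card Y < card Z" using False card_indep_le_rank[OF less.prems] Z by simp
      then obtain e where e: "e \<in> Z" "e \<notin> Y" "insert e Y \<in> indep_sets M"
        using is_matroid_augment[OF is_matroid_matroid less.prems(1) Z(1)] by blast
      have "card (insert e Y) = Suc (card Y)" using e finite_indep[OF less.prems(1)] by simp
      then have "rank_of M X - card (insert e Y) < rank_of M X - card Y" using lt Z by simp
      from less.hyps[OF this e(3)] show ?thesis using e Z less.prems by blast
    qed (use less.prems in blast)
  qed
  with that show thesis by blast
qed

text \<open>Submodularity of rank: bases \<open>A\<close>, \<open>B\<close>, \<open>C\<close> of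
  \<open>G\<close>, \<open>F\<close> and \<open>insert e F\<close> are chosen nested; then
  \<open>C\<close> contains \<open>e\<close>, so \<open>insert e A\<close> is independent.\<close>

lemma rank_insert_less_subset:
  assumes "G \<subseteq> F" "rank_of M F < rank_of M (insert e F)"
  shows "rank_of M G < rank_of M (insert e G)"
proof -
  obtain A where A: "A \<in> indep_sets M" "A \<subseteq> G" "card A = rank_of M G" by (rule rank_witness)
  obtain B where B: "B \<in> indep_sets M" "A \<subseteq> B" "B \<subseteq> F" "card B = rank_of M F"
    using indep_extend[of A M F] A assms(1) by blast
  obtain C where C: "C \<in> indep_sets M" "B \<subseteq> C" "C \<subseteq> insert e F" "card C = rank_of M (insert e F)"
    using indep_extend[of B M "insert e F"] B by blast
  have "e \<in> C"
  proof (rule ccontr)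
    assume "e \<notin> C"
    then have "card C \<le> rank_of M F" using C by (intro card_indep_le_rank) auto
    then show False using C assms by simp
  qed
  have "e \<notin> A"
  proof
    assume "e \<in> A"
    then have "insert e F = F" using A assms(1) by auto
    then show False using assms(2) by simp
  qed
  have "insert e A \<in> indep_sets M" using \<open>e \<in> C\<close> B C by (intro indep_downward[OF C(1)]) auto
  then have "card (insert e A) \<le> rank_of M (insert e G)"
    using A by (intro card_indep_le_rank) auto
  then show ?thesis using \<open>e \<notin> A\<close> A finite_indep[OF A(1)] by simp
qed

lemma basis_of_iff:
  "basis_of (indep_sets M) F B \<longleftrightarrow> B \<in> indep_sets M \<and> B \<subseteq> F \<and> card B = rank_of M F"
proof
  assume B: "basis_of (indep_sets M) F B"
  then have BI: "B \<in> indep_sets M" "B \<subseteq> F" by (auto simp: basis_of_def)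
  obtain C where "C \<in> indep_sets M" "B \<subseteq> C" "C \<subseteq> F" "card C = rank_of M F"
    using indep_extend[OF BI] by blast
  with B show "B \<in> indep_sets M \<and> B \<subseteq> F \<and> card B = rank_of M F" by (auto simp: basis_of_def)
next
  assume B: "B \<in> indep_sets M \<and> B \<subseteq> F \<and> card B = rank_of M F"
  have "C = B" if "C \<in> indep_sets M" "B \<subseteq> C" "C \<subseteq> F" for C
    using that B card_indep_le_rank[of C M F] card_seteq[of C B] finite_indep by metis
  with B show "basis_of (indep_sets M) F B" by (auto simp: basis_of_def)
qed

lemma indep_iff_rank: "X \<in> indep_sets M \<longleftrightarrow> X \<subseteq> ground M \<and> rank_of M X = card X"
proof (intro iffI conjI)
  assume X: "X \<in> indep_sets M"
  show "X \<subseteq> ground M" using X by (rule indep_subset_ground)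
  obtain Y where "Y \<in> indep_sets M" "Y \<subseteq> X" "card Y = rank_of M X" by (rule rank_witness)
  then show "rank_of M X = card X"
    using card_indep_le_rank[OF X order_refl] card_mono[OF finite_indep[OF X], of Y] by simp
next
  assume X: "X \<subseteq> ground M \<and> rank_of M X = card X"
  obtain Y where Y: "Y \<in> indep_sets M" "Y \<subseteq> X" "card Y = rank_of M X" by (rule rank_witness)
  then have "Y = X" using X by (metis card_subset_eq finite_ground finite_subset)
  with Y show "X \<in> indep_sets M" by simp
qed

text \<open>Minors are compared through their rank functions, which determine the independent
  sets.\<close>

lemma matroid_eqI:
  assumes "ground M = ground N" "\<And>X. X \<subseteq> ground M \<Longrightarrow> rank_of M X = rank_of N X"
  shows "M = N"
proof -
  have "indep_sets M = indep_sets N" using assms by (auto simp: indep_iff_rank)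
  with assms(1) have "Rep_matroid M = Rep_matroid N"
    by (intro prod_eqI) (simp_all add: ground.rep_eq indep_sets.rep_eq)
  then show ?thesis by (simp add: Rep_matroid_inject)
qed

section \<open>Rank in localizations and contractions\<close>

lemma ground_localization [simp]: "ground (localization M F) = ground M \<inter> F"
  by (simp add: ground.rep_eq indep_sets.rep_eq localization.rep_eq split_beta)

lemma indep_localization: "indep_sets (localization M F) = {X \<in> indep_sets M. X \<subseteq> F}"
  by (simp add: ground.rep_eq indep_sets.rep_eq localization.rep_eq split_beta)

lemma rank_localization: "rank_of (localization M F) X = rank_of M (X \<inter> F)"
proof -
  have "{Y \<in> indep_sets (localization M F). Y \<subseteq> X} = {Y \<in> indep_sets M. Y \<subseteq> X \<inter> F}"
    by (auto simp: indep_localization)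
  then show ?thesis unfolding rank_of_def by simp
qed

lemma ground_contraction [simp]: "ground (contraction M F) = ground M - F"
  by (simp add: ground.rep_eq indep_sets.rep_eq contraction.rep_eq split_beta)

lemma indep_contraction: "indep_sets (contraction M F) =
    {X. X \<subseteq> ground M - F \<and> (\<exists>B. basis_of (indep_sets M) F B \<and> X \<union> B \<in> indep_sets M)}"
  by (simp add: ground.rep_eq indep_sets.rep_eq contraction.rep_eq split_beta)

lemma rank_contraction:
  assumes "X \<subseteq> ground M - F"
  shows "rank_of (contraction M F) X = rank_of M (X \<union> F) - rank_of M F"
proof (rule antisym)
  obtain Y where Y: "Y \<in> indep_sets (contraction M F)" "Y \<subseteq> X" "card Y = rank_of (contraction M F) X"
    by (rule rank_witness)
  then obtain B where B: "B \<in> indep_sets M" "B \<subseteq> F" "card B = rank_of M F" "Y \<union> B \<in> indep_sets M"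
    by (auto simp: indep_contraction basis_of_iff)
  have "Y \<inter> B = {}" using assms Y B by blast
  then have "card (Y \<union> B) = card Y + card B"
    using B finite_indep Y by (metis card_Un_disjoint)
  moreover have "card (Y \<union> B) \<le> rank_of M (X \<union> F)"
    using Y B by (intro card_indep_le_rank) auto
  ultimately show "rank_of (contraction M F) X \<le> rank_of M (X \<union> F) - rank_of M F" using Y B by simp
next
  obtain B where B: "B \<in> indep_sets M" "B \<subseteq> F" "card B = rank_of M F" by (rule rank_witness)
  obtain C where C: "C \<in> indep_sets M" "B \<subseteq> C" "C \<subseteq> X \<union> F" "card C = rank_of M (X \<union> F)"
    using indep_extend[of B M "X \<union> F"] B by blast
  \<comment> \<open>\<open>B\<close> already has the largest size of an independent subset of
    \<open>F\<close>, so extending it to \<open>C\<close> adds nothing inside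
    \<open>F\<close>.\<close>
  have "C \<inter> F = B"
  proof -
    have "card (C \<inter> F) \<le> card B" unfolding B(3) using indep_downward[OF C(1)]
      by (intro card_indep_le_rank) auto
    moreover have "B \<subseteq> C \<inter> F" "finite (C \<inter> F)" using B C finite_indep[OF C(1)] by auto
    ultimately show ?thesis by (metis card_seteq)
  qed
  then have CB: "C - B \<subseteq> X" using C by auto
  have "C - B \<in> indep_sets (contraction M F)"
    unfolding indep_contraction basis_of_iff using B C CB assms
    by (auto simp: Un_absorb2 intro!: exI[of _ B])
  then have "card (C - B) \<le> rank_of (contraction M F) X" using CB by (rule card_indep_le_rank)
  moreover have "card (C - B) = rank_of M (X \<union> F) - rank_of M F"
    using B C finite_indep[OF B(1)] by (simp add: card_Diff_subset)
  ultimately show "rank_of M (X \<union> F) - rank_of M F \<le> rank_of (contraction M F) X" by simp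
qed

lemma rk_contraction: "F \<subseteq> ground M \<Longrightarrow> rk (contraction M F) = rk M - rank_of M F"
  by (simp add: rk_def rank_contraction Un_absorb2)

lemma contraction_empty [simp]: "contraction M {} = M"
  by (rule matroid_eqI) (simp_all add: rank_contraction)

text \<open>Allows sums over flats of a contraction to be written as sums over flats of
  \<open>M\<close>, with contractions of \<open>M\<close> itself in the summands.\<close>

lemma contraction_contraction:
  assumes "F \<subseteq> G" "G \<subseteq> ground M"
  shows "contraction (contraction M F) (G - F) = contraction M G"
proof (rule matroid_eqI)
  show "ground (contraction (contraction M F) (G - F)) = ground (contraction M G)"
    using assms by auto
next
  fix X assume "X \<subseteq> ground (contraction (contraction M F) (G - F))"
  then have X: "X \<subseteq> ground M - G" using assms by auto
  have "X \<union> (G - F) \<union> F = X \<union> G" "G - F \<union> F = G" using assms by auto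
  moreover have "X \<union> (G - F) \<subseteq> ground M - F" "G - F \<subseteq> ground M - F" "X \<subseteq> ground M - F - (G - F)"
    using X assms by auto
  ultimately show "rank_of (contraction (contraction M F) (G - F)) X = rank_of (contraction M G) X"
    using X rank_mono[OF assms(1), of M] by (simp add: rank_contraction)
qed

section \<open>The lattice of flats\<close>

lemma finite_flats [simp]: "finite (flats M)"
  by (rule finite_subset[of _ "Pow (ground M)"]) (auto simp: flats_def)

lemma flats_subset_ground: "F \<in> flats M \<Longrightarrow> F \<subseteq> ground M"
  by (simp add: flats_def)

lemma ground_in_flats [simp]: "ground M \<in> flats M"
  by (simp add: flats_def)

lemma flats_rank_strict_mono:
  assumes "F \<in> flats M" "G \<in> flats M" "F \<subset> G"
  shows "rank_of M F < rank_of M G"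
proof -
  obtain e where e: "e \<in> G" "e \<notin> F" using assms(3) by auto
  then have "rank_of M F < rank_of M (insert e F)" using assms by (auto simp: flats_def)
  also have "\<dots> \<le> rank_of M G" using e assms(3) by (intro rank_mono) auto
  finally show ?thesis .
qed

text \<open>The bottom of the lattice of flats, i.e. the closure of the empty set; it is nonempty
  for matroids with loops.\<close>

definition loops :: "'a matroid \<Rightarrow> 'a set" where
  "loops M = {e \<in> ground M. {e} \<notin> indep_sets M}"

lemma rank_loops [simp]: "rank_of M (loops M) = 0"
proof -
  obtain Y where Y: "Y \<in> indep_sets M" "Y \<subseteq> loops M" "card Y = rank_of M (loops M)"
    by (rule rank_witness)
  have "Y = {}"
  proof (rule ccontr)
    assume "Y \<noteq> {}"
    then obtain e where "e \<in> Y" by auto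
    then have "{e} \<in> indep_sets M" using Y by (intro indep_downward[OF Y(1)]) auto
    with \<open>e \<in> Y\<close> Y show False by (auto simp: loops_def)
  qed
  with Y show ?thesis by simp
qed

lemma loops_in_flats [simp]: "loops M \<in> flats M"
proof -
  have "0 < rank_of M (insert e (loops M))" if "e \<in> ground M - loops M" for e
    using card_indep_le_rank[of "{e}" M "insert e (loops M)"] that by (auto simp: loops_def)
  moreover have "loops M \<subseteq> ground M" by (auto simp: loops_def)
  ultimately show ?thesis by (simp add: flats_def)
qed

lemma loops_subset_flat:
  assumes "F \<in> flats M"
  shows "loops M \<subseteq> F"
proof (rule ccontr)
  assume "\<not> loops M \<subseteq> F"
  then obtain e where e: "e \<in> loops M" "e \<notin> F" by auto
  then have "rank_of M F < rank_of M (insert e F)" using assms by (auto simp: flats_def loops_def)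
  then have "rank_of M {} < rank_of M {e}" using rank_insert_less_subset[of "{}" F M e] by simp
  moreover have "rank_of M {e} \<le> rank_of M (loops M)" using e by (intro rank_mono) auto
  ultimately show False by simp
qed

lemma rank_flat_eq_0_iff: "F \<in> flats M \<Longrightarrow> rank_of M F = 0 \<longleftrightarrow> F = loops M"
  using flats_rank_strict_mono[OF loops_in_flats, of F M] loops_subset_flat[of F M]
  by (cases "F = loops M") (simp_all add: psubset_eq)

text \<open>For \<open>e\<close> outside \<open>F\<close>, adding \<open>e\<close> raises the rank
  of the flat \<open>F\<close> and hence, by submodularity, that of its subset
  \<open>G\<close>.\<close>

lemma flats_localization:
  assumes "F \<in> flats M"
  shows "flats (localization M F) = {G \<in> flats M. G \<subseteq> F}"
proof (intro subset_antisym subsetI)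
  fix G assume G: "G \<in> flats (localization M F)"
  then have sub: "G \<subseteq> ground M" "G \<subseteq> F" by (auto simp: flats_def)
  have "rank_of M G < rank_of M (insert e G)" if e: "e \<in> ground M - G" for e
  proof (cases "e \<in> F")
    case True
    then have "rank_of (localization M F) G < rank_of (localization M F) (insert e G)"
      using G e by (auto simp: flats_def)
    moreover have "G \<inter> F = G" "insert e G \<inter> F = insert e G" using sub True by auto
    ultimately show ?thesis by (simp add: rank_localization)
  next
    case False
    then have "rank_of M F < rank_of M (insert e F)" using assms e by (auto simp: flats_def)
    with sub(2) show ?thesis by (rule rank_insert_less_subset)
  qed
  with sub show "G \<in> {G \<in> flats M. G \<subseteq> F}" by (auto simp: flats_def)
next
  fix G assume G: "G \<in> {G \<in> flats M. G \<subseteq> F}"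
  have "rank_of (localization M F) G < rank_of (localization M F) (insert e G)"
    if e: "e \<in> ground M \<inter> F - G" for e
  proof -
    have "G \<inter> F = G" "insert e G \<inter> F = insert e G" using G e by auto
    then show ?thesis using G e by (auto simp: rank_localization flats_def)
  qed
  then show "G \<in> flats (localization M F)" using G by (auto simp: flats_def)
qed

lemma flats_contraction:
  assumes "F \<subseteq> ground M"
  shows "flats (contraction M F) = (\<lambda>G. G - F) ` {G \<in> flats M. F \<subseteq> G}"
proof -
  have iff: "H \<in> flats (contraction M F) \<longleftrightarrow> H \<union> F \<in> flats M" if H: "H \<subseteq> ground M - F" for H
  proof -
    \<comment> \<open>Both contracted ranks are natural-number differences; monotonicity excludes
      truncation, so the common \<open>rank_of M F\<close> cancels.\<close>
    have "rank_of (contraction M F) H < rank_of (contraction M F) (insert e H) \<longleftrightarrow>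
        rank_of M (H \<union> F) < rank_of M (insert e (H \<union> F))" if "e \<in> ground M - F - H" for e
      using H that rank_mono[of F "H \<union> F" M] rank_mono[of F "insert e (H \<union> F)" M]
      by (auto simp: rank_contraction less_diff_iff)
    moreover have "ground M - F - H = ground M - (H \<union> F)" by auto
    ultimately show ?thesis using H assms by (auto simp: flats_def)
  qed
  show ?thesis
  proof (intro subset_antisym subsetI)
    fix H assume H: "H \<in> flats (contraction M F)"
    then have sub: "H \<subseteq> ground M - F" by (auto simp: flats_def)
    with iff H have "H \<union> F \<in> {G \<in> flats M. F \<subseteq> G}" by simp
    moreover have "H = (H \<union> F) - F" using sub by auto
    ultimately show "H \<in> (\<lambda>G. G - F) ` {G \<in> flats M. F \<subseteq> G}" by blast
  next
    fix H assume "H \<in> (\<lambda>G. G - F) ` {G \<in> flats M. F \<subseteq> G}"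
    then obtain G where G: "G \<in> flats M" "F \<subseteq> G" "H = G - F" by auto
    then have "H \<subseteq> ground M - F" "H \<union> F = G" using flats_subset_ground[OF G(1)] by auto
    with iff G show "H \<in> flats (contraction M F)" by simp
  qed
qed

lemma sum_flats_contraction:
  assumes "F \<subseteq> ground M"
  shows "(\<Sum>H\<in>flats (contraction M F). f H) = (\<Sum>G | G \<in> flats M \<and> F \<subseteq> G. f (G - F))"
proof -
  have "inj_on (\<lambda>G. G - F) {G \<in> flats M. F \<subseteq> G}" by (auto simp: inj_on_def)
  then show ?thesis unfolding flats_contraction[OF assms] by (simp add: sum.reindex)
qed

section \<open>Kazhdan--Lusztig polynomials via palindromic Z-polynomials\<close>

lemma coeff_reverse_poly:
  assumes "degree p \<le> n"
  shows "coeff (reverse_poly n p) i = (if i \<le> n then coeff p (n - i) else 0)"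
proof (cases "p = 0")
  case False
  consider "i < n - degree p" | "n - degree p \<le> i" "i \<le> n" | "n < i" by linarith
  then show ?thesis
  proof cases
    case 1
    then have "coeff p (n - i) = 0" by (intro coeff_eq_0) simp
    with 1 show ?thesis by (simp add: reverse_poly_def coeff_monom_mult)
  next
    case 2
    then have "degree p - (i - (n - degree p)) = n - i" using assms by simp
    with 2 assms show ?thesis by (auto simp: reverse_poly_def coeff_monom_mult coeff_reflect_poly)
  next
    case 3
    with assms show ?thesis by (auto simp: reverse_poly_def coeff_monom_mult coeff_reflect_poly)
  qed
qed (simp add: reverse_poly_def)

text \<open>The recursion at \<open>y\<close> involves only elements below \<open>y\<close>, which
  all survive the restriction. Moebius values of a localization thus become values in the whole
  lattice of flats.\<close>

lemma mobius_restrict: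
  assumes "finite L" "y \<le> h"
  shows "mobius {z \<in> L. z \<le> h} x y = mobius L x y"
  using assms(2)
proof (induction "card {z \<in> L. z < y}" arbitrary: y rule: less_induct)
  case less
  have "(\<Sum>z | z \<in> {z \<in> L. z \<le> h} \<and> x \<le> z \<and> z < y. mobius {z \<in> L. z \<le> h} x z) =
      (\<Sum>z | z \<in> L \<and> x \<le> z \<and> z < y. mobius L x z)"
  proof (rule sum.cong)
    show "{z. z \<in> {z \<in> L. z \<le> h} \<and> x \<le> z \<and> z < y} = {z. z \<in> L \<and> x \<le> z \<and> z < y}"
      using less.prems by (auto intro: less_imp_le less_le_trans)
    fix z assume z: "z \<in> {z. z \<in> L \<and> x \<le> z \<and> z < y}"
    then have "{w \<in> L. w < z} \<subset> {w \<in> L. w < y}" by auto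
    then have "card {w \<in> L. w < z} < card {w \<in> L. w < y}"
      using assms(1) by (intro psubset_card_mono) auto
    then show "mobius {z \<in> L. z \<le> h} x z = mobius L x z"
      using z less.prems by (intro less.hyps) auto
  qed
  then show ?case using assms(1) by (subst (1 2) mobius.simps) simp
qed

section \<open>Construction by palindromic completion\<close>

definition half_palindromic :: "nat \<Rightarrow> int poly \<Rightarrow> int poly" where
  "half_palindromic r S = (\<Sum>i | 2 * i < r. monom (coeff S (r - i) - coeff S i) i)"

text \<open>Adding this polynomial to \<open>S\<close> overwrites each coefficient at
  \<open>i\<close> below \<open>r / 2\<close> by the one at \<open>r - i\<close>, which forces
  palindromicity.\<close>

lemma coeff_half_palindromic:
  "coeff (half_palindromic r S) i = (if 2 * i < r then coeff S (r - i) - coeff S i else 0)"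
proof -
  have "finite {i. 2 * i < r}" by (rule finite_subset[of _ "{..r}"]) auto
  then show ?thesis by (simp add: half_palindromic_def coeff_sum coeff_monom)
qed

lemma degree_half_palindromic:
  assumes "0 < r"
  shows "2 * degree (half_palindromic r S) < r"
proof -
  have "degree (half_palindromic r S) \<le> (r - 1) div 2"
    by (intro degree_le) (auto simp: coeff_half_palindromic)
  with assms show ?thesis by linarith
qed

text \<open>Only flats of positive rank are contracted: contracting \<open>loops M\<close> leaves
  the rank unchanged, so its summand would break the recursion on the rank.\<close>

function kl :: "'a matroid \<Rightarrow> int poly" where
  "kl M = (if rk M = 0 then 1 else half_palindromic (rk M)
     (\<Sum>F | F \<in> flats M \<and> 0 < rank_of M F. monom 1 (rank_of M F) * kl (contraction M F)))"
  by auto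
termination
  by (relation "measure rk") (auto simp: rk_contraction flats_subset_ground)

declare kl.simps [simp del]

text \<open>The Z-polynomial without the summand of the bottom flat, which is \<open>kl M\<close>
  itself by \<open>kl_contraction_loops\<close> below.\<close>

definition Z_tail :: "'a matroid \<Rightarrow> int poly" where
  "Z_tail M = (\<Sum>F | F \<in> flats M \<and> 0 < rank_of M F. monom 1 (rank_of M F) * kl (contraction M F))"

lemma kl_Z_tail: "kl M = (if rk M = 0 then 1 else half_palindromic (rk M) (Z_tail M))"
  by (subst kl.simps) (simp add: Z_tail_def)

lemma degree_kl: "0 < rk M \<Longrightarrow> 2 * degree (kl M) < rk M"
  by (simp add: kl_Z_tail degree_half_palindromic)

lemma degree_kl_le: "degree (kl M) \<le> rk M"
  using degree_kl[of M] by (cases "rk M = 0") (auto simp: kl_Z_tail)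

text \<open>Of two distinct exponents \<open>j\<close> and \<open>rk M - j\<close> exactly one lies
  below half the rank, and there \<open>kl M\<close> contributes the difference of the two
  coefficients of \<open>Z_tail M\<close>.\<close>

lemma Z_palindromic:
  assumes "j \<le> rk M"
  shows "coeff (kl M + Z_tail M) (rk M - j) = coeff (kl M + Z_tail M) j"
proof (cases "rk M - j = j")
  case False
  then show ?thesis using assms by (auto simp: kl_Z_tail coeff_half_palindromic)
qed simp

lemma Z_tail_contraction:
  assumes F: "F \<in> flats M"
  shows "Z_tail (contraction M F) =
    (\<Sum>G | G \<in> flats M \<and> F \<subset> G. monom 1 (rank_of M G - rank_of M F) * kl (contraction M G))"
proof -
  have FE: "F \<subseteq> ground M" using F by (rule flats_subset_ground)
  have rank: "rank_of (contraction M F) (G - F) = rank_of M G - rank_of M F"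
    if "G \<in> flats M" "F \<subseteq> G" for G
    using that flats_subset_ground[OF that(1)] by (simp add: rank_contraction Diff_mono Un_absorb2)
  have "Z_tail (contraction M F) = (\<Sum>H\<in>flats (contraction M F).
      if 0 < rank_of (contraction M F) H
      then monom 1 (rank_of (contraction M F) H) * kl (contraction (contraction M F) H) else 0)"
    unfolding Z_tail_def by (simp add: sum.inter_filter)
  also have "\<dots> = (\<Sum>G | G \<in> flats M \<and> F \<subseteq> G. if F \<subset> G
      then monom 1 (rank_of M G - rank_of M F) * kl (contraction M G) else 0)"
    unfolding sum_flats_contraction[OF FE]
  proof (intro sum.cong refl)
    fix G assume G: "G \<in> {G. G \<in> flats M \<and> F \<subseteq> G}"
    have "0 < rank_of M G - rank_of M F \<longleftrightarrow> F \<subset> G"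
      using G F flats_rank_strict_mono[of F M G] by auto
    moreover have "contraction (contraction M F) (G - F) = contraction M G"
      using G flats_subset_ground[of G M] by (intro contraction_contraction) auto
    ultimately show "(if 0 < rank_of (contraction M F) (G - F)
        then monom 1 (rank_of (contraction M F) (G - F)) * kl (contraction (contraction M F) (G - F)) else 0) =
      (if F \<subset> G then monom 1 (rank_of M G - rank_of M F) * kl (contraction M G) else 0)"
      using G rank by simp
  qed
  also have "\<dots> = (\<Sum>G | G \<in> flats M \<and> F \<subset> G. monom 1 (rank_of M G - rank_of M F) * kl (contraction M G))"
    by (subst sum.inter_filter[symmetric]) (auto intro!: sum.cong)
  finally show ?thesis .
qed

text \<open>The flats of positive rank are those strictly above \<open>loops M\<close>, so both
  polynomials arise from the same rank and the same tail.\<close>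

lemma kl_contraction_loops: "kl (contraction M (loops M)) = kl M"
proof -
  have "{G. G \<in> flats M \<and> loops M \<subset> G} = {G. G \<in> flats M \<and> 0 < rank_of M G}"
    using rank_flat_eq_0_iff loops_subset_flat by fastforce
  then have "Z_tail (contraction M (loops M)) = Z_tail M"
    unfolding Z_tail_contraction[OF loops_in_flats] by (simp add: Z_tail_def)
  moreover have "rk (contraction M (loops M)) = rk M"
    by (simp add: rk_contraction flats_subset_ground)
  ultimately show ?thesis by (simp add: kl_Z_tail)
qed

text \<open>The right side is the Z-polynomial of \<open>contraction M F\<close>, hence palindromic;
  the left side is its reversal in degree \<open>n\<close>, the rank of that contraction.\<close>

lemma sum_reverse_kl:
  assumes F: "F \<in> flats M"
  shows "(\<Sum>G | G \<in> flats M \<and> F \<subseteq> G. reverse_poly (rk M - rank_of M G) (kl (contraction M G))) =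
    (\<Sum>G | G \<in> flats M \<and> F \<subseteq> G. monom 1 (rank_of M G - rank_of M F) * kl (contraction M G))"
    (is "?L = ?R")
proof (rule poly_eqI)
  fix j
  let ?A = "{G. G \<in> flats M \<and> F \<subseteq> G}"
  define n where "n = rk M - rank_of M F"
  have n: "n = rk (contraction M F)" using F by (simp add: n_def rk_contraction flats_subset_ground)
  have rank: "rank_of M F \<le> rank_of M G" "rank_of M G \<le> rk M"
      "degree (kl (contraction M G)) \<le> rk M - rank_of M G" if "G \<in> ?A" for G
    using that degree_kl_le[of "contraction M G"] flats_subset_ground[of G M]
    by (auto intro: rank_mono simp: rk_def[of M] rk_contraction)
  have R: "?R = kl (contraction M F) + Z_tail (contraction M F)"
  proof -
    have "?A = insert F {G. G \<in> flats M \<and> F \<subset> G}" using F by auto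
    then show ?thesis unfolding Z_tail_contraction[OF F] by simp
  qed
  have L: "coeff ?L j = (\<Sum>G\<in>?A. if j \<le> rk M - rank_of M G
      then coeff (kl (contraction M G)) (rk M - rank_of M G - j) else 0)"
    unfolding coeff_sum by (intro sum.cong refl coeff_reverse_poly rank)
  have R': "coeff ?R k = (\<Sum>G\<in>?A. if k < rank_of M G - rank_of M F then 0
      else coeff (kl (contraction M G)) (k - (rank_of M G - rank_of M F)))" for k
    unfolding coeff_sum coeff_monom_mult mult_1 ..
  show "coeff ?L j = coeff ?R j"
  proof (cases "j \<le> n")
    case True
    \<comment> \<open>Each summand is reversed in degree \<open>rk M - rank_of M G\<close> only; the
      shift by \<open>rank_of M G - rank_of M F\<close> accounts for the rest of
      \<open>n\<close>.\<close>
    have "coeff ?L j = coeff ?R (n - j)"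
      unfolding L R'
    proof (intro sum.cong refl)
      fix G assume "G \<in> ?A"
      note r = rank[OF this]
      have "n - j < rank_of M G - rank_of M F \<longleftrightarrow> \<not> j \<le> rk M - rank_of M G"
        "n - j - (rank_of M G - rank_of M F) = rk M - rank_of M G - j"
        using r True by (auto simp: n_def)
      then show "(if j \<le> rk M - rank_of M G then coeff (kl (contraction M G)) (rk M - rank_of M G - j) else 0) =
        (if n - j < rank_of M G - rank_of M F then 0
         else coeff (kl (contraction M G)) (n - j - (rank_of M G - rank_of M F)))" by simp
    qed
    also have "\<dots> = coeff ?R j"
      unfolding R n using True n by (intro Z_palindromic) simp
    finally show ?thesis .
  next
    case False
    have "coeff ?L j = 0" unfolding L using False rank(1) by (intro sum.neutral) (force simp: n_def)
    moreover have "coeff ?R j = 0" unfolding R'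
    proof (intro sum.neutral ballI)
      fix G assume "G \<in> ?A"
      note r = rank[OF this]
      then have "degree (kl (contraction M G)) < j - (rank_of M G - rank_of M F)"
        using False by (simp add: n_def)
      then show "(if j < rank_of M G - rank_of M F then 0
         else coeff (kl (contraction M G)) (j - (rank_of M G - rank_of M F))) = 0"
        by (simp add: coeff_eq_0)
    qed
    ultimately show ?thesis by simp
  qed
qed

section \<open>Moebius inversion over the lattice of flats\<close>

lemma matroid_char_poly_localization:
  assumes F: "F \<in> flats M"
  shows "matroid_char_poly (localization M F) = (\<Sum>G | G \<in> flats M \<and> G \<subseteq> F.
     monom (mobius (flats M) (loops M) G) (rank_of M F - rank_of M G))"
proof -
  have "ground M \<inter> F \<inter> F = F" using flats_subset_ground[OF F] by auto
  then have rk: "rk (localization M F) = rank_of M F" by (simp add: rk_def rank_localization)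
  have Least: "(LEAST G. G \<in> flats M \<and> G \<subseteq> F) = loops M"
    using loops_subset_flat F by (intro Least_equality) auto
  show ?thesis
    unfolding matroid_char_poly_def flats_localization[OF F] rk mem_Collect_eq Least
    by (intro sum.cong refl) (auto simp: mobius_restrict rank_localization Int_absorb2)
qed

lemma sum_mobius_flats:
  assumes F: "F \<in> flats M"
  shows "(\<Sum>G | G \<in> flats M \<and> G \<subseteq> F. mobius (flats M) (loops M) G) = (if F = loops M then 1 else 0)"
proof (cases "F = loops M")
  case True
  then have "{G. G \<in> flats M \<and> G \<subseteq> F} = {loops M}" using loops_subset_flat by auto
  then show ?thesis using True by (simp add: mobius.simps)
next
  case False
  let ?B = "{G. G \<in> flats M \<and> loops M \<subseteq> G \<and> G \<subset> F}"
  have "{G. G \<in> flats M \<and> G \<subseteq> F} = insert F ?B" using F loops_subset_flat by auto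
  moreover have "loops M \<subset> F" using loops_subset_flat[OF F] False by auto
  then have "mobius (flats M) (loops M) F = - (\<Sum>G\<in>?B. mobius (flats M) (loops M) G)"
    using False by (subst mobius.simps) simp
  ultimately show ?thesis using False by simp
qed

lemma smult_sum_right: "smult a (\<Sum>x\<in>A. f x) = (\<Sum>x\<in>A. smult a (f x))"
  by (induction A rule: infinite_finite_induct) (simp_all add: smult_add_right)

text \<open>Expanding the characteristic polynomials and collecting by the lower flat
  \<open>G\<close> gives inner sums that are Z-polynomials of contractions, replaceable by sums of
  reversals. Summing over \<open>G\<close> first then leaves only
  \<open>F = loops M\<close>.\<close>

lemma kl_recursion:
  "reverse_poly (rk M) (kl M) =
     (\<Sum>F\<in>flats M. matroid_char_poly (localization M F) * kl (contraction M F))"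
proof -
  let ?mu = "mobius (flats M) (loops M)"
  let ?rev = "\<lambda>F. reverse_poly (rk M - rank_of M F) (kl (contraction M F))"
  have swap: "(\<Sum>F\<in>flats M. \<Sum>G | G \<in> flats M \<and> G \<subseteq> F. h F G) =
      (\<Sum>G\<in>flats M. \<Sum>F | F \<in> flats M \<and> G \<subseteq> F. h F G)" for h :: "'a set \<Rightarrow> 'a set \<Rightarrow> int poly"
    by (rule sum.swap_restrict) simp_all
  have "(\<Sum>F\<in>flats M. matroid_char_poly (localization M F) * kl (contraction M F)) =
      (\<Sum>F\<in>flats M. \<Sum>G | G \<in> flats M \<and> G \<subseteq> F.
         monom (?mu G) (rank_of M F - rank_of M G) * kl (contraction M F))"
    by (intro sum.cong refl) (simp add: matroid_char_poly_localization sum_distrib_right)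
  also have "\<dots> = (\<Sum>G\<in>flats M. smult (?mu G) (\<Sum>F | F \<in> flats M \<and> G \<subseteq> F.
         monom 1 (rank_of M F - rank_of M G) * kl (contraction M F)))"
    unfolding swap smult_sum_right
    by (intro sum.cong refl) (simp add: smult_monom_mult del: mult_smult_left)
  also have "\<dots> = (\<Sum>G\<in>flats M. smult (?mu G) (\<Sum>F | F \<in> flats M \<and> G \<subseteq> F. ?rev F))"
    by (intro sum.cong refl) (simp add: sum_reverse_kl)
  also have "\<dots> = (\<Sum>F\<in>flats M. \<Sum>G | G \<in> flats M \<and> G \<subseteq> F. smult (?mu G) (?rev F))"
    unfolding swap smult_sum_right ..
  also have "\<dots> = (\<Sum>F\<in>flats M. if F = loops M then ?rev F else 0)"
  proof (intro sum.cong refl)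
    fix F assume "F \<in> flats M"
    have "(\<Sum>G | G \<in> flats M \<and> G \<subseteq> F. smult (?mu G) (?rev F)) =
        smult (\<Sum>G | G \<in> flats M \<and> G \<subseteq> F. ?mu G) (?rev F)"
      by (simp add: smult_sum)
    then show "(\<Sum>G | G \<in> flats M \<and> G \<subseteq> F. smult (?mu G) (?rev F)) =
        (if F = loops M then ?rev F else 0)"
      unfolding sum_mobius_flats[OF \<open>F \<in> flats M\<close>] by simp
  qed
  also have "\<dots> = reverse_poly (rk M) (kl M)"
    by (simp add: kl_contraction_loops)
  finally show ?thesis ..
qed

lemma kl_assignment_kl: "kl_assignment kl"
proof -
  have "kl M = 1" if "rk M = 0" for M :: "'a matroid" using that by (simp add: kl_Z_tail)
  then show "kl_assignment (kl :: 'a matroid \<Rightarrow> int poly)"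
    unfolding kl_assignment_def using degree_kl kl_recursion by blast
qed

section \<open>Uniqueness of the Kazhdan--Lusztig assignment\<close>

lemma reverse_poly_inject:
  assumes "degree p \<le> n" "degree q \<le> n" "reverse_poly n p = reverse_poly n q"
  shows "p = q"
proof (rule poly_eqI)
  fix i
  show "coeff p i = coeff q i"
  proof (cases "i \<le> n")
    case True
    then show ?thesis
      using arg_cong[OF assms(3), of "\<lambda>r. coeff r (n - i)"] assms(1,2) by (simp add: coeff_reverse_poly)
  qed (use assms in \<open>simp add: coeff_eq_0\<close>)
qed

text \<open>The difference \<open>p - q\<close> has exponents below \<open>n / 2\<close> only, its
  reversal exponents above \<open>n / 2\<close> only.\<close>

lemma reverse_poly_diff_eq:
  assumes p: "2 * degree p < n" and q: "2 * degree q < n"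
    and eq: "reverse_poly n p - reverse_poly n q = p - q"
  shows "p = q"
proof (rule poly_eqI)
  fix i
  show "coeff p i = coeff q i"
  proof (cases "2 * i < n")
    case True
    then have "coeff p (n - i) = 0" "coeff q (n - i) = 0" using p q by (auto intro!: coeff_eq_0)
    moreover have "coeff (reverse_poly n p - reverse_poly n q) i = coeff (p - q) i" unfolding eq ..
    ultimately show ?thesis using p q True by (simp add: coeff_reverse_poly)
  next
    case False
    then show ?thesis using p q by (simp add: coeff_eq_0)
  qed
qed

lemma matroid_char_poly_empty:
  assumes "ground M = {}"
  shows "matroid_char_poly M = 1"
proof -
  have "flats M = {{}}" using assms ground_in_flats[of M] by (auto simp: flats_def)
  moreover have "(LEAST F. F = {}) = ({} :: 'a set)" by (rule Least_equality) auto
  ultimately show ?thesis using assms by (simp add: matroid_char_poly_def mobius.simps rk_def)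
qed

text \<open>Induction on the size of the ground set, which contraction of any nonempty flat
  decreases, even one of rank 0. The summand left over is that of the empty flat, present exactly
  when \<open>M\<close> has no loops.\<close>

lemma kl_assignment_unique:
  assumes P: "kl_assignment P" and Q: "kl_assignment Q"
  shows "P M = Q M"
proof (induction "card (ground M)" arbitrary: M rule: less_induct)
  case less
  show ?case
  proof (cases "rk M = 0")
    case True
    then show ?thesis using P Q by (simp add: kl_assignment_def)
  next
    case False
    then have deg: "2 * degree (P M) < rk M" "2 * degree (Q M) < rk M"
      using P Q by (simp_all add: kl_assignment_def)
    let ?d = "\<lambda>F. matroid_char_poly (localization M F) * (P (contraction M F) - Q (contraction M F))"
    have IH: "?d F = 0" if "F \<in> flats M - {{}}" for F
    proof -
      have "ground M - F \<subset> ground M" using that flats_subset_ground[of F M] by auto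
      then have "card (ground (contraction M F)) < card (ground M)" by (simp add: psubset_card_mono)
      from less.hyps[OF this] show ?thesis by simp
    qed
    have "reverse_poly (rk M) (P M) - reverse_poly (rk M) (Q M) = (\<Sum>F\<in>flats M. ?d F)"
      using P Q by (simp add: kl_assignment_def sum_subtractf algebra_simps)
    also have "\<dots> = (\<Sum>F\<in>flats M \<inter> {{}}. ?d F)"
      using IH by (intro sum.mono_neutral_right) auto
    finally have diff: "reverse_poly (rk M) (P M) - reverse_poly (rk M) (Q M) =
        (\<Sum>F\<in>flats M \<inter> {{}}. ?d F)" .
    \<comment> \<open>Without loops the right side is \<open>P M - Q M\<close>, to be compared with
      its own reversal; with loops it is zero.\<close>
    show ?thesis
    proof (cases "{} \<in> flats M")
      case True
      then have "reverse_poly (rk M) (P M) - reverse_poly (rk M) (Q M) = P M - Q M"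
        using diff by (simp add: matroid_char_poly_empty)
      with deg show ?thesis by (rule reverse_poly_diff_eq)
    next
      case False
      then have "reverse_poly (rk M) (P M) = reverse_poly (rk M) (Q M)" using diff by simp
      then show ?thesis using deg by (intro reverse_poly_inject[of "P M" "rk M"]) linarith+
    qed
  qed
qed

lemma KL_poly_eq_kl: "KL_poly = kl"
  unfolding KL_poly_def
  by (rule the_equality) (use kl_assignment_kl kl_assignment_unique in blast)+

section \<open>Counting skew tableaux\<close>

definition linexts :: "('a \<Rightarrow> 'a \<Rightarrow> bool) \<Rightarrow> 'a set \<Rightarrow> ('a \<Rightarrow> nat) set" where
  "linexts R S = {f \<in> extensional S. bij_betw f S {1..card S} \<and>
     (\<forall>x\<in>S. \<forall>y\<in>S. R x y \<longrightarrow> f x < f y)}"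

definition maximals :: "('a \<Rightarrow> 'a \<Rightarrow> bool) \<Rightarrow> 'a set \<Rightarrow> 'a set" where
  "maximals R S = {x \<in> S. \<forall>y\<in>S. \<not> R x y}"

lemma finite_linexts: "finite S \<Longrightarrow> finite (linexts R S)"
  by (rule finite_subset[of _ "PiE S (\<lambda>_. {1..card S})"])
    (auto simp: linexts_def PiE_def bij_betw_def finite_PiE[unfolded PiE_def])

lemma linexts_empty [simp]: "linexts R {} = {\<lambda>_. undefined}"
  by (auto simp: linexts_def bij_betw_def)

text \<open>Restriction to \<open>S - {x}\<close> is inverted by giving \<open>x\<close> the value
  \<open>card S\<close>; maximality of \<open>x\<close> ensures that this top value violates no
  relation.\<close>

lemma card_linexts_top:
  assumes "finite S" "x \<in> maximals R S"
  shows "card {f \<in> linexts R S. f x = card S} = card (linexts R (S - {x}))"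
proof -
  let ?T = "S - {x}"
  have x: "x \<in> S" "\<And>y. y \<in> S \<Longrightarrow> \<not> R x y" using assms by (auto simp: maximals_def)
  have cS: "card S = Suc (card ?T)" using card_Suc_Diff1[OF assms(1) x(1)] by simp
  have "bij_betw (\<lambda>f. restrict f ?T) {f \<in> linexts R S. f x = card S} (linexts R ?T)"
  proof (rule bij_betw_byWitness[where f' = "\<lambda>g. g(x := card S)"])
    show "\<forall>f\<in>{f \<in> linexts R S. f x = card S}. (restrict f ?T)(x := card S) = f"
    proof (intro ballI ext)
      fix f y assume "f \<in> {f \<in> linexts R S. f x = card S}"
      then have "f \<in> extensional S" "f x = card S" by (simp_all add: linexts_def)
      then show "((restrict f ?T)(x := card S)) y = f y"
        by (cases "y \<in> ?T") (auto simp: extensional_def)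
    qed
    show "\<forall>g\<in>linexts R ?T. restrict (g(x := card S)) ?T = g"
    proof (intro ballI ext)
      fix g y assume "g \<in> linexts R ?T"
      then have "g \<in> extensional ?T" by (simp add: linexts_def)
      then show "restrict (g(x := card S)) ?T y = g y"
        by (cases "y \<in> ?T") (auto simp: extensional_def)
    qed
    show "(\<lambda>f. restrict f ?T) ` {f \<in> linexts R S. f x = card S} \<subseteq> linexts R ?T"
    proof clarify
      fix f assume f: "f \<in> linexts R S" "f x = card S"
      then have "bij_betw f S {1..card S}" by (simp add: linexts_def)
      then have "bij_betw f ?T ({1..card S} - {f x})"
        using x(1) by (auto simp: bij_betw_def inj_on_def)
      also have "{1..card S} - {f x} = {1..card ?T}" using f(2) cS by auto
      finally have "bij_betw (restrict f ?T) ?T {1..card ?T}"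
        by (rule bij_betw_cong[THEN iffD1, rotated]) simp
      moreover have "\<forall>u\<in>?T. \<forall>v\<in>?T. R u v \<longrightarrow> restrict f ?T u < restrict f ?T v"
        using f(1) by (simp add: linexts_def)
      ultimately show "restrict f ?T \<in> linexts R ?T"
        by (simp add: linexts_def)
    qed
    show "(\<lambda>g. g(x := card S)) ` linexts R ?T \<subseteq> {f \<in> linexts R S. f x = card S}"
    proof clarify
      fix g assume g: "g \<in> linexts R ?T"
      let ?f = "g(x := card S)"
      have bij: "bij_betw g ?T {1..card ?T}" using g by (simp add: linexts_def)
      then have "bij_betw ?f ?T {1..card ?T}"
        by (rule bij_betw_cong[THEN iffD1, rotated]) simp
      then have "bij_betw ?f (?T \<union> {x}) ({1..card ?T} \<union> {?f x})"
        by (intro notIn_Un_bij_betw) (use cS in auto)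
      moreover have "?T \<union> {x} = S" using x by auto
      moreover have "{1..card ?T} \<union> {?f x} = {1..card S}" using cS by auto
      ultimately have bij': "bij_betw ?f S {1..card S}" by simp
      have "g y < card S" if "y \<in> ?T" for y
        using bij_betwE[OF bij] that cS by force
      then have "\<forall>u\<in>S. \<forall>v\<in>S. R u v \<longrightarrow> ?f u < ?f v"
        using g x(2) by (auto simp: linexts_def)
      moreover have "?f \<in> extensional S" using g x(1) by (auto simp: linexts_def extensional_def)
      ultimately show "?f \<in> linexts R S \<and> ?f x = card S"
        using bij' by (simp add: linexts_def)
    qed
  qed
  then show ?thesis by (rule bij_betw_same_card)
qed

text \<open>The entry \<open>card S\<close> sits at a maximal element; the extensions are classified
  by its position.\<close>

lemma card_linexts_rec:
  assumes "finite S" "S \<noteq> {}"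
  shows "card (linexts R S) = (\<Sum>x\<in>maximals R S. card (linexts R (S - {x})))"
proof -
  let ?A = "\<lambda>x. {f \<in> linexts R S. f x = card S}"
  have "linexts R S = (\<Union>x\<in>maximals R S. ?A x)"
  proof (intro subset_antisym subsetI)
    fix f assume f: "f \<in> linexts R S"
    then have bij: "f ` S = {1..card S}" by (simp add: linexts_def bij_betw_def)
    moreover have "card S \<in> {1..card S}" using assms by (simp add: Suc_leI card_gt_0_iff)
    ultimately obtain x where x: "x \<in> S" "f x = card S" by (metis imageE)
    have "\<not> R x y" if "y \<in> S" for y
    proof
      assume "R x y"
      with f x that have "card S < f y" by (auto simp: linexts_def)
      moreover have "f y \<in> {1..card S}" using that bij by blast
      ultimately show False by simp
    qed
    with x f show "f \<in> (\<Union>x\<in>maximals R S. ?A x)" by (auto simp: maximals_def)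
  qed auto
  moreover have "card (\<Union>x\<in>maximals R S. ?A x) = (\<Sum>x\<in>maximals R S. card (?A x))"
  proof (rule card_UN_disjoint)
    show "\<forall>x\<in>maximals R S. \<forall>y\<in>maximals R S. x \<noteq> y \<longrightarrow> ?A x \<inter> ?A y = {}"
    proof (intro ballI impI equals0I)
      fix x y f assume "x \<in> maximals R S" "y \<in> maximals R S" "x \<noteq> y" and f: "f \<in> ?A x \<inter> ?A y"
      then have "inj_on f S" "x \<in> S" "y \<in> S" by (simp_all add: linexts_def bij_betw_def maximals_def)
      then show False using \<open>x \<noteq> y\<close> f inj_onD[of f S x y] by simp
    qed
  qed (use assms finite_linexts[of S R] in \<open>auto simp: maximals_def\<close>)
  ultimately show ?thesis using card_linexts_top[OF assms(1)] by simp
qed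

section \<open>Partition shapes with a chain above them\<close>

definition cell_less :: "nat \<times> nat \<Rightarrow> nat \<times> nat \<Rightarrow> bool" where
  "cell_less x y \<longleftrightarrow> fst x = fst y \<and> snd x < snd y \<or> snd x = snd y \<and> fst x < fst y"

text \<open>A partition shape \<open>(p, q, 1 ^ c)\<close> placed in the rows from \<open>B - 1\<close> on, and a chain of \<open>t\<close> cells
  in column \<open>C\<close>. The two are independent for \<open>p < C\<close>; for \<open>p = C\<close> and \<open>t + 2 = B\<close> the chain sits
  directly on top of the end of the first row.\<close>

definition shape :: "nat \<Rightarrow> nat \<Rightarrow> nat \<Rightarrow> nat \<Rightarrow> nat \<Rightarrow> nat \<Rightarrow> (nat \<times> nat) set" where
  "shape B C t p q c =
     {1..t} \<times> {C} \<union> {B - 1} \<times> {1..p} \<union> {B} \<times> {1..q} \<union> {B + 1..B + c} \<times> {1}"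

lemma finite_shape: "finite (shape B C t p q c)"
  by (simp add: shape_def)

text \<open>A first row of full length \<open>C\<close> requires the chain to end directly above it.
  In this form the condition is preserved when any maximal cell is removed.\<close>

definition shape_ok :: "nat \<Rightarrow> nat \<Rightarrow> nat \<Rightarrow> nat \<Rightarrow> nat \<Rightarrow> nat \<Rightarrow> bool" where
  "shape_ok B C t p q c \<longleftrightarrow>
     0 < C \<and> t + 2 \<le> B \<and> q \<le> p \<and> p \<le> C \<and> (0 < c \<longrightarrow> 0 < q) \<and> (p = C \<longrightarrow> t + 2 = B)"

lemma card_shape:
  assumes "shape_ok B C t p q c"
  shows "card (shape B C t p q c) = t + p + q + c"
proof -
  have "card (shape B C t p q c) = 
     card ({1..t} \<times> {C}) + card ({B - 1} \<times> {1..p}) + card ({B} \<times> {1..q}) + card ({B + 1..B + c} \<times> {1::nat})"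
    unfolding shape_def using assms
    by (subst card_Un_disjoint, simp, simp, force simp: shape_ok_def)+ simp
  then show ?thesis by (simp add: card_cartesian_product)
qed

lemma maximals_shape:
  assumes "shape_ok B C t p q c"
  shows "maximals cell_less (shape B C t p q c) =
    (if 1 \<le> t \<and> p < C then {(t, C)} else {}) \<union> (if q < p then {(B - 1, p)} else {}) \<union>
    (if 1 \<le> q \<and> (2 \<le> q \<or> c = 0) then {(B, q)} else {}) \<union> (if 1 \<le> c then {(B + c, 1)} else {})"
    (is "_ = ?R")
proof (intro subset_antisym subsetI)
  fix x assume x: "x \<in> maximals cell_less (shape B C t p q c)"
  then have max: "\<not> cell_less x y" if "y \<in> shape B C t p q c" for y
    using that by (auto simp: maximals_def)
  from x have "x \<in> shape B C t p q c" by (simp add: maximals_def)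
  then consider (1) r where "x = (r, C)" "1 \<le> r" "r \<le> t" | (2) k where "x = (B - 1, k)" "1 \<le> k" "k \<le> p"
    | (3) k where "x = (B, k)" "1 \<le> k" "k \<le> q" | (4) r where "x = (r, 1)" "B + 1 \<le> r" "r \<le> B + c"
    by (auto simp: shape_def)
  then show "x \<in> ?R"
  proof cases
    case 1
    have "\<not> r < t" using max[of "(t, C)"] 1 by (auto simp: shape_def cell_less_def)
    moreover have "\<not> p = C"
      using max[of "(B - 1, C)"] 1 assms by (auto simp: shape_def cell_less_def shape_ok_def)
    ultimately show ?thesis using 1 assms by (auto simp: shape_ok_def)
  next
    case 2
    have "\<not> k < p" using max[of "(B - 1, p)"] 2 by (auto simp: shape_def cell_less_def)
    moreover have "\<not> k \<le> q"
      using max[of "(B, k)"] 2 assms by (auto simp: shape_def cell_less_def shape_ok_def)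
    ultimately show ?thesis using 2 by auto
  next
    case 3
    have "\<not> k < q" using max[of "(B, q)"] 3 by (auto simp: shape_def cell_less_def)
    moreover have "\<not> (k = 1 \<and> 1 \<le> c)"
      using max[of "(B + 1, 1)"] 3 by (auto simp: shape_def cell_less_def)
    ultimately show ?thesis using 3 by auto
  next
    case 4
    have "\<not> r < B + c" using max[of "(B + c, 1)"] 4 by (auto simp: shape_def cell_less_def)
    then show ?thesis using 4 by auto
  qed
next
  fix x assume "x \<in> ?R"
  then consider (1) "x = (t, C)" "1 \<le> t" "p < C" | (2) "x = (B - 1, p)" "q < p"
    | (3) "x = (B, q)" "1 \<le> q" "2 \<le> q \<or> c = 0" | (4) "x = (B + c, 1)" "1 \<le> c"
    by (auto split: if_splits)
  then show "x \<in> maximals cell_less (shape B C t p q c)"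
    by cases (use assms in \<open>auto simp: maximals_def shape_def cell_less_def shape_ok_def\<close>)
qed

abbreviation shape_count :: "nat \<Rightarrow> nat \<Rightarrow> nat \<Rightarrow> nat \<Rightarrow> nat \<Rightarrow> nat \<Rightarrow> nat" where
  "shape_count B C t p q c \<equiv> card (linexts cell_less (shape B C t p q c))"

lemma shape_count_rec:
  assumes ok: "shape_ok B C t p q c" and pos: "0 < t + p + q + c"
  shows "shape_count B C t p q c =
    (if 1 \<le> t \<and> p < C then shape_count B C (t - 1) p q c else 0) +
    (if q < p then shape_count B C t (p - 1) q c else 0) +
    (if 1 \<le> q \<and> (2 \<le> q \<or> c = 0) then shape_count B C t p (q - 1) c else 0) +
    (if 1 \<le> c then shape_count B C t p q (c - 1) else 0)"
proof -
  let ?S = "shape B C t p q c"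
  have ne: "?S \<noteq> {}" using card_shape[OF ok] pos by auto
  have d: "B - 1 \<noteq> t" "B \<noteq> t" "B + c \<noteq> t" "B - 1 \<noteq> B" "B - 1 \<noteq> B + c" "t + 2 \<le> B"
    using ok by (auto simp: shape_ok_def)
  have "\<not> B + 1 \<le> B - 1" by simp
  have col: "{a..n} \<times> {k} - {(n, k)} = {a..n - 1} \<times> {k}"
    and row: "{k} \<times> {a..n} - {(k, n)} = {k} \<times> {a..n - 1}" if "1 \<le> n" for a n k :: nat
    using that by auto
  have 1: "?S - {(t, C)} = shape B C (t - 1) p q c" if "1 \<le> t"
    using that d col[of t 1 C] by (simp add: shape_def Un_Diff)
  have 2: "?S - {(B - 1, p)} = shape B C t (p - 1) q c" if "q < p"
    using that d \<open>\<not> B + 1 \<le> B - 1\<close> row[of p "B - 1" 1] by (simp add: shape_def Un_Diff)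
  have 3: "?S - {(B, q)} = shape B C t p (q - 1) c" if "1 \<le> q"
    using that d row[of q B 1] by (simp add: shape_def Un_Diff)
  have 4: "?S - {(B + c, 1)} = shape B C t p q (c - 1)" if "1 \<le> c"
    using that d col[of "B + c" "B + 1" 1] by (simp add: shape_def Un_Diff)
  have sums: "(\<Sum>x\<in>(if a then {u} else {}) \<union> (if b then {v} else {}) \<union> (if c then {w} else {}) \<union>
      (if d then {z} else {}). f x) = (if a then f u else 0) + (if b then f v else 0) +
      (if c then f w else 0) + (if d then f z else 0)"
    if "distinct [u, v, w, z]" for a b c d and u v w z :: "nat \<times> nat" and f :: "nat \<times> nat \<Rightarrow> nat"
  proof -
    have "v \<noteq> u" "w \<noteq> u" "w \<noteq> v" "z \<noteq> u" "z \<noteq> v" "z \<noteq> w" using that by auto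
    then show ?thesis by simp
  qed
  \<comment> \<open>For \<open>c = 0\<close> and \<open>q = 1\<close> the cells
    \<open>(B + c, 1)\<close> and \<open>(B, q)\<close> coincide; \<open>max c 1\<close> keeps the
    four candidates distinct without changing the set of maximal cells.\<close>
  have dist: "distinct [(t, C), (B - 1, p), (B, q), (B + max c 1, 1)]"
    using d by auto
  have max: "maximals cell_less ?S =
    (if 1 \<le> t \<and> p < C then {(t, C)} else {}) \<union> (if q < p then {(B - 1, p)} else {}) \<union>
    (if 1 \<le> q \<and> (2 \<le> q \<or> c = 0) then {(B, q)} else {}) \<union>
    (if 1 \<le> c then {(B + max c 1, 1)} else {})"
    unfolding maximals_shape[OF ok] by (simp add: max_absorb1)
  show ?thesis
    unfolding card_linexts_rec[OF finite_shape ne] max sums[OF dist]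
    using 1 2 3 4 by (simp add: max_absorb1)
qed

text \<open>By the hook length formula, the number of standard Young tableaux of shape \<open>(p, q, 1 ^ c)\<close>
  divided by the factorial of its size.\<close>

definition hook_weight :: "nat \<Rightarrow> nat \<Rightarrow> nat \<Rightarrow> real" where
  "hook_weight p q c =
     (if q = 0 then if c = 0 then 1 / fact p else 0
      else (real p + 1 - real q) /
        ((real p + real c + 1) * fact p * (real q + real c) * fact (q - 1) * fact c))"

text \<open>The branching rule for standard Young tableaux by the position of the largest entry,
  normalized by factorials. For the closed form it is an identity of rational functions.\<close>

lemma hook_weight_rec:
  assumes "q \<le> p" "0 < c \<longrightarrow> 0 < q"
  shows "real (p + q + c) * hook_weight p q c =
    (if q < p then hook_weight (p - 1) q c else 0) +
    (if 1 \<le> q \<and> (2 \<le> q \<or> c = 0) then hook_weight p (q - 1) c else 0) +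
    (if 1 \<le> c then hook_weight p q (c - 1) else 0)"
proof (cases "q = 0")
  case True
  then show ?thesis using assms by (cases p) (auto simp: hook_weight_def)
next
  case False
  then obtain q' where q: "q = Suc q'" by (cases q) auto
  obtain p' where p: "p = Suc p'" using assms q by (cases p) auto
  \<comment> \<open>The factor \<open>real p - real q\<close> also covers \<open>q = p\<close>,
    where the first row has no removable cell.\<close>
  have ppred: "(if q < p then hook_weight (p - 1) q c else 0) =
     (real p - real q) * real p /
        ((real p + real c) * fact p * (real q + real c) * fact (q - 1) * fact c)"
    using assms q p by (auto simp: hook_weight_def divide_simps)
  \<comment> \<open>For \<open>q = 1\<close> and \<open>c = 0\<close> a single row remains, whose
    weight comes from the other branch of \<open>hook_weight\<close>; the quotient, formally 0/0,
    has to be read as 1.\<close>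
  have qpred: "(if 1 \<le> q \<and> (2 \<le> q \<or> c = 0) then hook_weight p (q - 1) c else 0) =
     (real p + 2 - real q) * (if q = 1 \<and> c = 0 then 1 else (real q - 1) / (real q - 1 + real c)) /
        ((real p + real c + 1) * fact p * fact (q - 1) * fact c)"
  proof (cases q')
    case 0
    then show ?thesis using q by (simp add: hook_weight_def divide_simps)
  next
    case (Suc k)
    then show ?thesis using q by (simp add: hook_weight_def divide_simps)
  qed
  have cpred: "(if 1 \<le> c then hook_weight p q (c - 1) else 0) =
     (real p + 1 - real q) * real c /
        ((real p + real c) * fact p * (if c = 0 then 1 else real q + real c - 1) * fact (q - 1) * fact c)"
  proof (cases c)
    case (Suc k)
    have "real q + real c - 1 = real q + real k" "real p + real c = real p + real k + 1" using Suc by simp_all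
    then show ?thesis using q Suc by (simp add: hook_weight_def divide_simps, simp add: algebra_simps)
  qed simp
  \<comment> \<open>The common factor of all denominators; without it, a rational identity in
    \<open>P\<close>, \<open>Q\<close> and \<open>C\<close> remains.\<close>
  define D :: real where "D = fact p * fact (q - 1) * fact c"
  have D: "D > 0" by (simp add: D_def)
  define P Q C where "P = real p" and "Q = real q" and "C = real c"
  have pos: "P \<ge> 1" "Q \<ge> 1" "C \<ge> 0" using p q by (simp_all add: P_def Q_def C_def)
  have lhs: "real (p + q + c) * hook_weight p q c =
      (P + Q + C) * (P + 1 - Q) / ((P + C + 1) * (Q + C)) / D"
    using q by (simp add: hook_weight_def P_def Q_def C_def D_def divide_simps)
  have ppred': "(if q < p then hook_weight (p - 1) q c else 0) = P * (P - Q) / ((P + C) * (Q + C)) / D"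
    unfolding ppred P_def Q_def C_def D_def by (simp add: divide_simps)
  show ?thesis
  proof (cases "c = 0")
    case True
    have q1: "(if 1 \<le> q \<and> (2 \<le> q \<or> c = 0) then hook_weight p (q - 1) c else 0) =
      (P + 2 - Q) / (P + 1) / D"
      unfolding qpred using True q by (auto simp: P_def Q_def C_def D_def divide_simps)
    have c1: "(if 1 \<le> c then hook_weight p q (c - 1) else 0) = 0" using True by simp
    have "C = 0" using True by (simp add: C_def)
    then have "(P + Q + C) * (P + 1 - Q) / ((P + C + 1) * (Q + C)) =
       P * (P - Q) / ((P + C) * (Q + C)) + (P + 2 - Q) / (P + 1)"
      using pos by (simp add: divide_simps, simp add: algebra_simps)
    then show ?thesis unfolding lhs ppred' q1 c1 by (simp add: add_divide_distrib)
  next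
    case False
    have "C \<ge> 1" using False by (simp add: C_def)
    have q1: "(if 1 \<le> q \<and> (2 \<le> q \<or> c = 0) then hook_weight p (q - 1) c else 0) =
      (Q - 1) * (P + 2 - Q) / ((P + C + 1) * (Q - 1 + C)) / D"
      unfolding qpred using False q by (auto simp: P_def Q_def C_def D_def divide_simps)
    have c1: "(if 1 \<le> c then hook_weight p q (c - 1) else 0) =
      C * (P + 1 - Q) / ((P + C) * (Q + C - 1)) / D"
      unfolding cpred using False q by (simp add: P_def Q_def C_def D_def divide_simps)
    have "(P + Q + C) * (P + 1 - Q) / ((P + C + 1) * (Q + C)) =
       P * (P - Q) / ((P + C) * (Q + C)) + (Q - 1) * (P + 2 - Q) / ((P + C + 1) * (Q - 1 + C))
       + C * (P + 1 - Q) / ((P + C) * (Q + C - 1))"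
      using pos \<open>C \<ge> 1\<close> by (simp add: divide_simps, simp add: algebra_simps)
    then show ?thesis unfolding lhs ppred' q1 c1 by (simp add: add_divide_distrib)
  qed
qed

text \<open>Chain and partition are incomparable, so the count is a binomial coefficient, for the
  choice of the chain entries, times a number of standard Young tableaux. In the recursion, removing
  the chain end contributes the summand \<open>t\<close> of the total size.\<close>

lemma shape_count_detached:
  assumes "shape_ok B C t p q c" "p < C"
  shows "real (shape_count B C t p q c) = fact (t + p + q + c) * hook_weight p q c / fact t"
  using assms
proof (induction "t + p + q + c" arbitrary: t p q c rule: less_induct)
  case less
  show ?case
  proof (cases "t + p + q + c = 0")
    case True
    then show ?thesis by (simp add: shape_def hook_weight_def)
  next
    case False
    let ?n = "t + p + q + c"
    define F :: real where "F = fact (?n - 1)"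
    have F: "fact ?n = real ?n * F" using False by (simp add: F_def fact_reduce)
    have 1: "(if 1 \<le> t \<and> p < C then real (shape_count B C (t - 1) p q c) else 0) =
        F * (real t * hook_weight p q c) / fact t"
    proof (cases t)
      case (Suc s)
      have "shape_ok B C s p q c" using less.prems Suc by (simp add: shape_ok_def)
      with less Suc show ?thesis by (simp add: F_def divide_simps)
    qed simp
    have 2: "(if q < p then real (shape_count B C t (p - 1) q c) else 0) =
        F * (if q < p then hook_weight (p - 1) q c else 0) / fact t"
    proof (cases "q < p")
      case True
      then have "shape_ok B C t (p - 1) q c" using less.prems by (auto simp: shape_ok_def)
      moreover have "t + (p - 1) + q + c = ?n - 1" using True by simp
      ultimately show ?thesis
        using less.hyps[of t "p - 1" q c] less.prems True by (simp add: F_def)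
    qed auto
    have 3: "(if 1 \<le> q \<and> (2 \<le> q \<or> c = 0) then real (shape_count B C t p (q - 1) c) else 0) =
        F * (if 1 \<le> q \<and> (2 \<le> q \<or> c = 0) then hook_weight p (q - 1) c else 0) / fact t"
    proof (cases "1 \<le> q \<and> (2 \<le> q \<or> c = 0)")
      case True
      then have "shape_ok B C t p (q - 1) c" using less.prems by (auto simp: shape_ok_def)
      moreover have "t + p + (q - 1) + c = ?n - 1" using True by simp
      ultimately show ?thesis
        using less.hyps[of t p "q - 1" c] less.prems True by (simp add: F_def)
    qed auto
    have 4: "(if 1 \<le> c then real (shape_count B C t p q (c - 1)) else 0) =
        F * (if 1 \<le> c then hook_weight p q (c - 1) else 0) / fact t"
    proof (cases "1 \<le> c")
      case True
      then have "shape_ok B C t p q (c - 1)" using less.prems by (auto simp: shape_ok_def)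
      moreover have "t + p + q + (c - 1) = ?n - 1" using True by simp
      ultimately show ?thesis
        using less.hyps[of t p q "c - 1"] less.prems True by (simp add: F_def)
    qed auto
    have "q \<le> p" "0 < c \<longrightarrow> 0 < q" using less.prems by (auto simp: shape_ok_def)
    note rec = hook_weight_rec[OF this, symmetric]
    have "real (shape_count B C t p q c) =
       (if 1 \<le> t \<and> p < C then real (shape_count B C (t - 1) p q c) else 0) +
       (if q < p then real (shape_count B C t (p - 1) q c) else 0) +
       (if 1 \<le> q \<and> (2 \<le> q \<or> c = 0) then real (shape_count B C t p (q - 1) c) else 0) +
       (if 1 \<le> c then real (shape_count B C t p q (c - 1)) else 0)"
      using shape_count_rec[OF less.prems(1)] False by simp
    also have "\<dots> = F * (real t * hook_weight p q c +
       ((if q < p then hook_weight (p - 1) q c else 0) +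
        (if 1 \<le> q \<and> (2 \<le> q \<or> c = 0) then hook_weight p (q - 1) c else 0) +
        (if 1 \<le> c then hook_weight p q (c - 1) else 0))) / fact t"
      unfolding 1 2 3 4 by (simp only: add_divide_distrib distrib_left add.assoc)
    also have "\<dots> = fact ?n * hook_weight p q c / fact t"
      unfolding rec F by (simp add: algebra_simps)
    finally show ?thesis .
  qed
qed

text \<open>Inclusion--exclusion: fillings of the disconnected shape in which the lowest chain entry exceeds
  the end of the first row are those with that entry moved to the end of the first row.\<close>

definition attached_weight :: "nat \<Rightarrow> nat \<Rightarrow> nat \<Rightarrow> nat \<Rightarrow> real" where
  "attached_weight t p q c = (\<Sum>s\<le>t. (-1) ^ s * hook_weight (p + s) q c / fact (t - s))"

text \<open>The terms in which the chain or the first row shrinks telescope.\<close>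

lemma attached_weight_rec:
  assumes "q \<le> p" "0 < c \<longrightarrow> 0 < q"
  shows "real (t + p + q + c) * attached_weight t p q c =
    (if q < p then hook_weight (p - 1) q c else 0) / fact t +
    (if 1 \<le> q \<and> (2 \<le> q \<or> c = 0) then attached_weight t p (q - 1) c else 0) +
    (if 1 \<le> c then attached_weight t p q (c - 1) else 0)"
proof -
  let ?b = "1 \<le> q \<and> (2 \<le> q \<or> c = 0)"
  \<comment> \<open>The weight after shrinking a first row of \<open>p + s\<close> cells; only at
    \<open>s = 0\<close> can the second row block this.\<close>
  define h where "h s = (if s = 0 then (if q < p then hook_weight (p - 1) q c else 0)
    else hook_weight (p + s - 1) q c)" for s
  define T where "T s = (if s \<le> t then (-1) ^ s * h s / fact (t - s) else 0)" for s
  have summand: "real (t + p + q + c) * ((-1) ^ s * hook_weight (p + s) q c / fact (t - s)) =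
      (T s - T (Suc s)) +
      (if ?b then (-1) ^ s * hook_weight (p + s) (q - 1) c / fact (t - s) else 0) +
      (if 1 \<le> c then (-1) ^ s * hook_weight (p + s) q (c - 1) / fact (t - s) else 0)"
    if s: "s \<le> t" for s
  proof -
    have rec: "real (p + s + q + c) * hook_weight (p + s) q c = h s +
       (if ?b then hook_weight (p + s) (q - 1) c else 0) +
       (if 1 \<le> c then hook_weight (p + s) q (c - 1) else 0)"
      using hook_weight_rec[of q "p + s" c] assms by (auto simp: h_def)
    \<comment> \<open>Shrinking the chain at index \<open>s\<close> gives the term of shrinking the
      row at \<open>s + 1\<close> with opposite sign; at \<open>s = t\<close> no chain is left and
      the cutoff in \<open>T\<close> gives zero.\<close>
    have T: "- T (Suc s) = (-1) ^ s * (real (t - s) * hook_weight (p + s) q c) / fact (t - s)"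
    proof (cases "s = t")
      case False
      then obtain u where "t - s = Suc u" using s by (cases "t - s") auto
      moreover from this have "t - Suc s = u" by simp
      ultimately show ?thesis using s False by (simp add: T_def h_def divide_simps)
    qed (simp add: T_def)
    have "real (t + p + q + c) * hook_weight (p + s) q c =
        real (t - s) * hook_weight (p + s) q c + real (p + s + q + c) * hook_weight (p + s) q c"
      using s by (simp add: algebra_simps of_nat_diff)
    then have "real (t + p + q + c) * ((-1) ^ s * hook_weight (p + s) q c / fact (t - s)) =
       - T (Suc s) + (-1) ^ s * (real (p + s + q + c) * hook_weight (p + s) q c) / fact (t - s)"
      unfolding T by (simp add: algebra_simps add_divide_distrib)
    also have "\<dots> = - T (Suc s) + T s +
      (if ?b then (-1) ^ s * hook_weight (p + s) (q - 1) c / fact (t - s) else 0) +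
      (if 1 \<le> c then (-1) ^ s * hook_weight (p + s) q (c - 1) / fact (t - s) else 0)"
      unfolding rec using s by (auto simp: T_def add_divide_distrib algebra_simps)
    finally show ?thesis by simp
  qed
  have "real (t + p + q + c) * attached_weight t p q c =
     (\<Sum>s\<le>t. T s - T (Suc s)) +
     (\<Sum>s\<le>t. if ?b then (-1) ^ s * hook_weight (p + s) (q - 1) c / fact (t - s) else 0) +
     (\<Sum>s\<le>t. if 1 \<le> c then (-1) ^ s * hook_weight (p + s) q (c - 1) / fact (t - s) else 0)"
    unfolding attached_weight_def sum_distrib_left sum.distrib[symmetric]
    by (intro sum.cong refl summand) simp
  also have "(\<Sum>s\<le>t. T s - T (Suc s)) = T 0 - T (Suc t)" by (rule sum_telescope)
  finally show ?thesis by (auto simp: T_def h_def attached_weight_def)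
qed

text \<open>Removing the end of the first row detaches the chain and leads to
  \<open>shape_count_detached\<close>; the other removals keep the shape attached and lower
  \<open>q + c\<close>. The chain end is never maximal, as the first row lies below it.\<close>

lemma shape_count_attached:
  assumes "shape_ok B C t C q c"
  shows "real (shape_count B C t C q c) = fact (t + C + q + c) * attached_weight t C q c"
  using assms
proof (induction "q + c" arbitrary: q c rule: less_induct)
  case less
  let ?n = "t + C + q + c"
  define F :: real where "F = fact (?n - 1)"
  have "0 < C" using less.prems by (simp add: shape_ok_def)
  then have F: "fact ?n = real ?n * F" by (simp add: F_def fact_reduce)
  have 2: "(if q < C then real (shape_count B C t (C - 1) q c) else 0) =
      F * ((if q < C then hook_weight (C - 1) q c else 0) / fact t)"
  proof (cases "q < C")
    case True
    then have "shape_ok B C t (C - 1) q c" using less.prems by (auto simp: shape_ok_def)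
    moreover have "t + (C - 1) + q + c = ?n - 1" using True by simp
    ultimately show ?thesis using True by (simp add: F_def shape_count_detached)
  qed simp
  have 3: "(if 1 \<le> q \<and> (2 \<le> q \<or> c = 0) then real (shape_count B C t C (q - 1) c) else 0) =
      F * (if 1 \<le> q \<and> (2 \<le> q \<or> c = 0) then attached_weight t C (q - 1) c else 0)"
  proof (cases "1 \<le> q \<and> (2 \<le> q \<or> c = 0)")
    case True
    then have "shape_ok B C t C (q - 1) c" using less.prems by (auto simp: shape_ok_def)
    moreover have "t + C + (q - 1) + c = ?n - 1" using True by simp
    ultimately show ?thesis using less.hyps[of "q - 1" c] True by (simp add: F_def)
  qed auto
  have 4: "(if 1 \<le> c then real (shape_count B C t C q (c - 1)) else 0) =
      F * (if 1 \<le> c then attached_weight t C q (c - 1) else 0)"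
  proof (cases "1 \<le> c")
    case True
    then have "shape_ok B C t C q (c - 1)" using less.prems by (auto simp: shape_ok_def)
    moreover have "t + C + q + (c - 1) = ?n - 1" using True by simp
    ultimately show ?thesis using less.hyps[of q "c - 1"] True by (simp add: F_def)
  qed auto
  have "q \<le> C" "0 < c \<longrightarrow> 0 < q" using less.prems by (auto simp: shape_ok_def)
  note rec = attached_weight_rec[OF this, symmetric]
  have "real (shape_count B C t C q c) =
     (if q < C then real (shape_count B C t (C - 1) q c) else 0) +
     (if 1 \<le> q \<and> (2 \<le> q \<or> c = 0) then real (shape_count B C t C (q - 1) c) else 0) +
     (if 1 \<le> c then real (shape_count B C t C q (c - 1)) else 0)"
    using shape_count_rec[OF less.prems] \<open>0 < C\<close> by simp
  also have "\<dots> = F * (real ?n * attached_weight t C q c)"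
    unfolding 2 3 4 distrib_left[symmetric] rec ..
  finally show ?case unfolding F by simp
qed

text \<open>Besides the two full rows of \<open>i + 1\<close> cells, \<open>c = a - 2\<close> cells
  lie below in the first column and \<open>t = b - 2\<close> above in the last one.\<close>

lemma card_SkYT:
  assumes "1 \<le> i"
  shows "real (card (SkYT (c + 2) i (t + 2))) =
     fact (t + 2 * i + c + 2) * attached_weight t (i + 1) (i + 1) c"
proof -
  have ok: "shape_ok (t + 2) (i + 1) t (i + 1) (i + 1) c" by (simp add: shape_ok_def)
  have cells: "skew_cells (c + 2) i (t + 2) = shape (t + 2) (i + 1) t (i + 1) (i + 1) c"
    unfolding skew_cells_def shape_def by auto
  have "card (skew_cells (c + 2) i (t + 2)) = (c + 2) + 2 * i + (t + 2) - 2"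
    unfolding cells card_shape[OF ok] by simp
  then have "SkYT (c + 2) i (t + 2) = linexts cell_less (skew_cells (c + 2) i (t + 2))"
    unfolding SkYT_def linexts_def cell_less_def by auto
  moreover have "t + (i + 1) + (i + 1) + c = t + 2 * i + c + 2" by simp
  ultimately show ?thesis
    using shape_count_attached[OF ok] unfolding cells by metis
qed

section \<open>Symmetry of the Z-coefficients\<close>

lemma alternating_binomial_sum_Suc:
  fixes f :: "nat \<Rightarrow> real"
  shows "(\<Sum>k\<le>Suc n. (-1) ^ k * real (Suc n choose k) * f k) =
    (\<Sum>k\<le>n. (-1) ^ k * real (n choose k) * (f k - f (Suc k)))"
proof -
  have "(\<Sum>k\<le>n. (-1) ^ k * real (n choose k) * f k) = (\<Sum>k\<le>Suc n. (-1) ^ k * real (n choose k) * f k)"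
    by simp
  also have "\<dots> = f 0 + (\<Sum>k\<le>n. (-1) ^ Suc k * real (n choose Suc k) * f (Suc k))"
    by (subst sum.atMost_Suc_shift) simp
  finally have eq: "(\<Sum>k\<le>n. (-1) ^ k * real (n choose k) * f k) =
      f 0 + (\<Sum>k\<le>n. (-1) ^ Suc k * real (n choose Suc k) * f (Suc k))" .
  have "(\<Sum>k\<le>Suc n. (-1) ^ k * real (Suc n choose k) * f k) =
      f 0 + (\<Sum>k\<le>n. (-1) ^ Suc k * real (Suc n choose Suc k) * f (Suc k))"
    by (subst sum.atMost_Suc_shift) simp
  also have "(\<Sum>k\<le>n. (-1) ^ Suc k * real (Suc n choose Suc k) * f (Suc k)) =
     (\<Sum>k\<le>n. (-1) ^ Suc k * real (n choose Suc k) * f (Suc k)) -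
     (\<Sum>k\<le>n. (-1) ^ k * real (n choose k) * f (Suc k))"
    unfolding sum_subtractf[symmetric] by (intro sum.cong) (simp_all add: algebra_simps)
  also have "f 0 + \<dots> = (\<Sum>k\<le>n. (-1) ^ k * real (n choose k) * f k) -
     (\<Sum>k\<le>n. (-1) ^ k * real (n choose k) * f (Suc k))"
    unfolding eq by simp
  also have "\<dots> = (\<Sum>k\<le>n. (-1) ^ k * real (n choose k) * (f k - f (Suc k)))"
    unfolding sum_subtractf[symmetric] by (intro sum.cong) (simp_all add: algebra_simps)
  finally show ?thesis .
qed

text \<open>The Beta integral of \<open>x^m * (1 - x)^n\<close> over the unit interval, expanded
  binomially. In the induction on \<open>n\<close>, shifting \<open>k\<close> in the difference
  amounts to shifting \<open>m\<close>.\<close>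

lemma alternating_binomial_sum_inverse:
  "(\<Sum>k\<le>n. (-1) ^ k * real (n choose k) * (1 / real (m + 1 + k))) = fact n * fact m / fact (m + n + 1)"
proof (induction n arbitrary: m)
  case (Suc n)
  have "(\<Sum>k\<le>Suc n. (-1) ^ k * real (Suc n choose k) * (1 / real (m + 1 + k))) =
     (\<Sum>k\<le>n. (-1) ^ k * real (n choose k) * (1 / real (m + 1 + k))) -
     (\<Sum>k\<le>n. (-1) ^ k * real (n choose k) * (1 / real (Suc m + 1 + k)))"
    unfolding alternating_binomial_sum_Suc sum_subtractf[symmetric]
    by (intro sum.cong) (simp_all add: algebra_simps)
  also have "\<dots> = fact n * fact m / fact (m + n + 1) - fact n * fact (Suc m) / fact (Suc m + n + 1)"
    unfolding Suc.IH ..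
  also have "\<dots> = fact (Suc n) * fact m / fact (m + Suc n + 1)"
  proof -
    have "fact (Suc m + n + 1) = (real m + real n + 2) * fact (m + n + 1)"
      "fact (m + Suc n + 1) = (real m + real n + 2) * fact (m + n + 1)"
      by simp_all
    then show ?thesis by (simp del: fact_Suc add: divide_simps) (simp add: algebra_simps)
  qed
  finally show ?case .
qed simp

text \<open>The coefficients of \<open>exp (- z)\<close> and of \<open>- exp (- z) * (\<Sum>s\<ge>1. z ^ s / (m + s)!)\<close>.\<close>

definition exp_coeff :: "nat \<Rightarrow> real" where
  "exp_coeff r = (-1) ^ r / fact r"

definition tail_coeff :: "nat \<Rightarrow> nat \<Rightarrow> real" where
  "tail_coeff m r = (-1) ^ r * real r / (real (m + r) * fact r * fact m)"

text \<open>The coefficient of \<open>z^p\<close> in \<open>exp (- z) * exp z = 1\<close>.\<close>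

lemma sum_exp_coeff:
  assumes "1 \<le> p"
  shows "(\<Sum>r\<le>p. exp_coeff r / fact (p - r)) = 0"
proof -
  have "(\<Sum>r\<le>p. exp_coeff r / fact (p - r)) = (\<Sum>r\<le>p. (-1) ^ r * real (p choose r)) / fact p"
    unfolding sum_divide_distrib exp_coeff_def by (intro sum.cong) (simp_all add: binomial_fact)
  then show ?thesis using choose_alternating_sum[of p, where ?'a = real] assms by simp
qed

text \<open>The coefficient of \<open>z^p\<close> after multiplication by \<open>exp z\<close>. The
  factor \<open>r\<close> in \<open>tail_coeff\<close> kills the term at 0 and lowers the factorial,
  which leaves a Beta sum.\<close>

lemma sum_tail_coeff:
  assumes "1 \<le> p"
  shows "(\<Sum>r\<le>p. tail_coeff m r / fact (p - r)) = - 1 / fact (m + p)"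
proof -
  obtain n where p: "p = Suc n" using assms by (cases p) auto
  have "(\<Sum>r\<le>p. tail_coeff m r / fact (p - r)) = (\<Sum>r\<le>n. tail_coeff m (Suc r) / fact (n - r))"
    unfolding p by (subst sum.atMost_Suc_shift) (simp add: tail_coeff_def)
  also have "\<dots> = - (\<Sum>r\<le>n. (-1) ^ r * real (n choose r) * (1 / real (m + 1 + r))) / (fact n * fact m)"
    unfolding sum_negf[symmetric] sum_divide_distrib
  proof (intro sum.cong refl)
    fix r assume "r \<in> {..n}"
    then have "real (n choose r) = fact n / (fact r * fact (n - r))" by (simp add: binomial_fact)
    then show "tail_coeff m (Suc r) / fact (n - r) =
        - ((-1) ^ r * real (n choose r) * (1 / real (m + 1 + r))) / (fact n * fact m)"
      by (simp add: tail_coeff_def divide_simps)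
  qed
  also have "\<dots> = - 1 / fact (m + p)"
    unfolding alternating_binomial_sum_inverse p by simp
  finally show ?thesis .
qed

text \<open>For \<open>i < r\<close> and \<open>m = c + 1\<close> this is, up to sign,
  \<open>hook_weight r (i + 1) c\<close>; the formula extends it antisymmetrically to all
  \<open>r\<close> and \<open>i\<close>.\<close>

definition skew_coeff :: "nat \<Rightarrow> nat \<Rightarrow> nat \<Rightarrow> real" where
  "skew_coeff m r i = tail_coeff m i * exp_coeff r - tail_coeff m r * exp_coeff i"

text \<open>The tableau count divided by \<open>(m + d)!\<close>, for \<open>p = d - i\<close> and
  positive \<open>d\<close>. This \<open>p\<close> is constant along the sum for a
  Z-coefficient.\<close>

definition SkYT_density :: "nat \<Rightarrow> nat \<Rightarrow> nat \<Rightarrow> real" where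
  "SkYT_density m p i = (\<Sum>r\<in>{i<..p}. skew_coeff m r i / fact (p - r))"

text \<open>For positive \<open>p\<close> and \<open>q\<close>, the Z-coefficient of exponent
  \<open>q\<close> in rank \<open>p + q\<close>, divided by \<open>(m + p + q)!\<close>;
  palindromicity becomes symmetry in \<open>p\<close> and \<open>q\<close>.\<close>

definition Z_density :: "nat \<Rightarrow> nat \<Rightarrow> nat \<Rightarrow> real" where
  "Z_density m p q = (\<Sum>i\<le>q. SkYT_density m p i / fact (q - i))"

text \<open>By antisymmetry the difference of the two triangular sums is a sum over the full
  rectangle. It splits into two products, each with a factor that vanishes by
  \<open>sum_exp_coeff\<close>.\<close>

lemma Z_density_commute:
  assumes "1 \<le> p" "1 \<le> q"
  shows "Z_density m p q = Z_density m q p"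
proof -
  let ?w = "\<lambda>r i. skew_coeff m r i / (fact (p - r) * fact (q - i))"
  have expand: "Z_density m p q =
      (\<Sum>i\<le>q. \<Sum>r\<le>p. if i < r then skew_coeff m r i / (fact (p - r) * fact (q - i)) else 0)" for p q
    unfolding Z_density_def SkYT_density_def sum_divide_distrib
    by (subst sum.inter_filter[OF finite_atMost, symmetric], intro sum.cong) auto
  have "Z_density m q p = (\<Sum>i\<le>q. \<Sum>r\<le>p. if r < i then - ?w r i else 0)"
    unfolding expand by (subst sum.swap)
      (intro sum.cong refl, auto simp: skew_coeff_def mult.commute minus_divide_left)
  then have "Z_density m p q - Z_density m q p =
      (\<Sum>i\<le>q. \<Sum>r\<le>p. (if i < r then ?w r i else 0) - (if r < i then - ?w r i else 0))"
    unfolding expand[of p q] by (simp only: sum_subtractf)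
  also have "\<dots> = (\<Sum>i\<le>q. \<Sum>r\<le>p. ?w r i)"
    by (intro sum.cong refl) (auto simp: skew_coeff_def not_less_iff_gr_or_eq)
  also have "\<dots> = (\<Sum>i\<le>q. \<Sum>r\<le>p. (tail_coeff m i / fact (q - i)) * (exp_coeff r / fact (p - r))) -
     (\<Sum>i\<le>q. \<Sum>r\<le>p. (exp_coeff i / fact (q - i)) * (tail_coeff m r / fact (p - r)))"
    unfolding sum_subtractf[symmetric]
    by (intro sum.cong refl) (simp add: skew_coeff_def diff_divide_distrib mult.commute)
  also have "\<dots> = 0"
    unfolding sum_product[symmetric] using assms by (simp add: sum_exp_coeff)
  finally show ?thesis by simp
qed

section \<open>Tableau counts in terms of the antisymmetric form\<close>

definition uniform_coeff :: "nat \<Rightarrow> nat \<Rightarrow> nat \<Rightarrow> int" where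
  "uniform_coeff m d i = int (num_SkYT (int m + 1) i (int d - 2 * int i + 1))"

lemma uniform_coeff_0 [simp]: "uniform_coeff m d 0 = 1"
  by (simp add: uniform_coeff_def num_SkYT_def)

lemma uniform_coeff_eq_0:
  assumes "0 < i" "d \<le> 2 * i"
  shows "uniform_coeff m d i = 0"
  using assms by (auto simp: uniform_coeff_def num_SkYT_def)

text \<open>The hook length factor \<open>r - i\<close> comes from the difference of
  \<open>i / (m + i)\<close> and \<open>r / (m + r)\<close>, where \<open>m = c + 1\<close>.\<close>

lemma skew_coeff_hook_weight:
  assumes "i < r"
  shows "skew_coeff (Suc c) r i = (-1) ^ (r - Suc i) * hook_weight r (Suc i) c"
proof -
  obtain s where r: "r = i + Suc s" using assms less_imp_Suc_add by fastforce
  have sign: "(-1 :: real) ^ i * (-1) ^ r = - ((-1) ^ s)" unfolding r by (simp add: power_add)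
  have "skew_coeff (Suc c) r i = ((-1) ^ i * (-1) ^ r) * (real i / real (Suc c + i) - real r / real (Suc c + r))
      / (fact i * fact r * fact (Suc c))"
    by (simp add: skew_coeff_def tail_coeff_def exp_coeff_def diff_divide_distrib algebra_simps)
  also have "real i / real (Suc c + i) - real r / real (Suc c + r) =
      - (real (Suc c) * (real r - real i) / (real (Suc c + i) * real (Suc c + r)))"
    by (simp add: divide_simps) (simp add: algebra_simps)
  also have "((-1) ^ i * (-1) ^ r) * \<dots> / (fact i * fact r * fact (Suc c)) =
      (-1) ^ s * hook_weight r (Suc i) c"
    unfolding sign by (simp add: hook_weight_def divide_simps) (simp add: algebra_simps)
  finally show ?thesis by (simp add: r)
qed

text \<open>The conventions for degenerate tableaux fit the formula: \<open>i = 0\<close> gives 1 by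
  \<open>sum_tail_coeff\<close>, and for \<open>i > 0\<close> the case \<open>d \<le> 2 * i\<close>
  has an empty range. In the generic case \<open>r = i + 1 + s\<close> matches
  \<open>attached_weight\<close>.\<close>

lemma uniform_coeff_SkYT_density:
  assumes "0 < d"
  shows "real_of_int (uniform_coeff m d i) = fact (m + d) * SkYT_density m (d - i) i"
proof (cases "i = 0")
  case True
  have "{..d} = insert 0 {0<..d}" by auto
  then have "(\<Sum>r\<le>d. tail_coeff m r / fact (d - r)) = (\<Sum>r\<in>{0<..d}. tail_coeff m r / fact (d - r))"
    by (simp add: tail_coeff_def)
  moreover have "SkYT_density m d 0 = - (\<Sum>r\<in>{0<..d}. tail_coeff m r / fact (d - r))"
    by (simp add: SkYT_density_def skew_coeff_def sum_negf tail_coeff_def[of m 0] exp_coeff_def)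
  ultimately have "SkYT_density m d 0 = 1 / fact (m + d)" using sum_tail_coeff[of d m] assms by simp
  then show ?thesis using True by simp
next
  case False
  show ?thesis
  proof (cases "d \<le> 2 * i")
    case True
    then have "{i<..d - i} = {}" by auto
    then show ?thesis using uniform_coeff_eq_0[of i d m] True False by (simp add: SkYT_density_def)
  next
    case big: False
    show ?thesis
    proof (cases m)
      case 0
      \<comment> \<open>At positive indices \<open>tail_coeff 0\<close> agrees with
        \<open>exp_coeff\<close>, so the antisymmetric form vanishes.\<close>
      have "skew_coeff 0 r i = 0" if "i < r" for r
        using that False by (simp add: skew_coeff_def tail_coeff_def exp_coeff_def)
      then have "SkYT_density m (d - i) i = 0" unfolding SkYT_density_def 0 by simp
      then show ?thesis using False 0 by (simp add: uniform_coeff_def num_SkYT_def)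
    next
      case (Suc c)
      obtain t where d: "d = 2 * i + 1 + t" using big by (metis not_less_eq_eq Suc_eq_plus1 le_add_diff_inverse)
      have "num_SkYT (int m + 1) i (int d - 2 * int i + 1) = card (SkYT (c + 2) i (t + 2))"
        using False by (simp add: num_SkYT_def d Suc nat_add_distrib)
      then have "real_of_int (uniform_coeff m d i) =
          fact (t + 2 * i + c + 2) * attached_weight t (i + 1) (i + 1) c"
        using card_SkYT[of i c t] False by (simp add: uniform_coeff_def)
      also have "t + 2 * i + c + 2 = m + d" by (simp add: d Suc)
      also have "attached_weight t (i + 1) (i + 1) c = SkYT_density m (d - i) i"
        unfolding attached_weight_def SkYT_density_def
        by (rule sum.reindex_bij_witness[of _ "\<lambda>r. r - (i + 1)" "\<lambda>s. i + 1 + s"])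
          (auto simp: d Suc skew_coeff_hook_weight)
      finally show ?thesis .
    qed
  qed
qed

text \<open>The factor \<open>(m + d) choose k\<close> turns \<open>(m + d - k)!\<close> into
  \<open>(m + d)! / k!\<close>, so both sums are \<open>(m + d)!\<close> times values of
  \<open>Z_density\<close>.\<close>

lemma uniform_coeff_palindromic:
  assumes "0 < j" "j < d"
  shows "(\<Sum>k\<le>j. int ((m + d) choose k) * uniform_coeff m (d - k) (j - k)) =
    (\<Sum>k\<le>d - j. int ((m + d) choose k) * uniform_coeff m (d - k) (d - j - k))"
proof -
  have eq: "real_of_int (\<Sum>k\<le>j. int ((m + d) choose k) * uniform_coeff m (d - k) (j - k)) =
     fact (m + d) * Z_density m (d - j) j" if j: "j < d" for j
  proof -
    have "real_of_int (\<Sum>k\<le>j. int ((m + d) choose k) * uniform_coeff m (d - k) (j - k)) =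
      (\<Sum>k\<le>j. fact (m + d) * (SkYT_density m (d - j) (j - k) / fact k))"
      unfolding of_int_sum
    proof (intro sum.cong refl)
      fix k assume k: "k \<in> {..j}"
      then have "d - k - (j - k) = d - j" "m + (d - k) = m + d - k" using j by auto
      then have "real_of_int (uniform_coeff m (d - k) (j - k)) =
          fact (m + d - k) * SkYT_density m (d - j) (j - k)"
        using uniform_coeff_SkYT_density[of "d - k" m "j - k"] j k by simp
      moreover have "real ((m + d) choose k) = fact (m + d) / (fact k * fact (m + d - k))"
        using j k by (intro binomial_fact) auto
      ultimately show "real_of_int (int ((m + d) choose k) * uniform_coeff m (d - k) (j - k)) =
          fact (m + d) * (SkYT_density m (d - j) (j - k) / fact k)"
        by simp
    qed
    also have "\<dots> = (\<Sum>i\<le>j. fact (m + d) * (SkYT_density m (d - j) i / fact (j - i)))"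
      by (rule sum.reindex_bij_witness[of _ "\<lambda>i. j - i" "\<lambda>k. j - k"]) auto
    finally show ?thesis by (simp only: Z_density_def sum_distrib_left)
  qed
  have "d - (d - j) = j" using assms by simp
  then have "fact (m + d) * Z_density m (d - j) j = fact (m + d) * Z_density m (d - (d - j)) (d - j)"
    using Z_density_commute[of "d - j" j m] assms by simp
  then have "real_of_int (\<Sum>k\<le>j. int ((m + d) choose k) * uniform_coeff m (d - k) (j - k)) =
    real_of_int (\<Sum>k\<le>d - j. int ((m + d) choose k) * uniform_coeff m (d - k) (d - j - k))"
    using assms by (subst eq, simp, subst eq, simp_all)
  then show ?thesis by (simp only: of_int_eq_iff)
qed

section \<open>Uniform matroids\<close>

text \<open>Uniformity on an arbitrary ground set, a class closed under contraction of sets of size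
  at most \<open>d\<close>; contractions of \<open>uniform_matroid\<close> leave the ground sets
  \<open>{1..n}\<close>.\<close>

definition uniform_rank :: "'a matroid \<Rightarrow> nat \<Rightarrow> bool" where
  "uniform_rank M d \<longleftrightarrow> d \<le> card (ground M) \<and> (\<forall>X. X \<subseteq> ground M \<longrightarrow> rank_of M X = min (card X) d)"

lemma uniform_rankD:
  assumes "uniform_rank M d"
  shows "d \<le> card (ground M)" "X \<subseteq> ground M \<Longrightarrow> rank_of M X = min (card X) d" "rk M = d"
  using assms by (auto simp: uniform_rank_def rk_def)

lemma uniform_rank_contraction:
  assumes M: "uniform_rank M d" and F: "F \<subseteq> ground M" "card F \<le> d"
  shows "uniform_rank (contraction M F) (d - card F)"
  unfolding uniform_rank_def
proof (intro conjI allI impI)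
  have finF: "finite F" using F finite_ground finite_subset by metis
  show "d - card F \<le> card (ground (contraction M F))"
    using uniform_rankD(1)[OF M] F finF by (simp add: card_Diff_subset)
  fix X assume "X \<subseteq> ground (contraction M F)"
  then have X: "X \<subseteq> ground M - F" by simp
  then have "finite X" by (meson finite_Diff finite_ground finite_subset)
  with X finF have "card (X \<union> F) = card X + card F" by (intro card_Un_disjoint) auto
  moreover have "X \<union> F \<subseteq> ground M" using X F by auto
  ultimately show "rank_of (contraction M F) X = min (card X) (d - card F)"
    using F by (simp add: rank_contraction[OF X] uniform_rankD(2)[OF M])
qed

lemma flats_uniform_rank:
  assumes M: "uniform_rank M d"
  shows "flats M = insert (ground M) {F. F \<subseteq> ground M \<and> card F < d}"
proof (intro subset_antisym subsetI)
  fix F assume F: "F \<in> flats M"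
  then have sub: "F \<subseteq> ground M" by (rule flats_subset_ground)
  have "card F < d" if "F \<noteq> ground M"
  proof -
    obtain e where e: "e \<in> ground M" "e \<notin> F" using sub \<open>F \<noteq> ground M\<close> by blast
    then have "rank_of M F < rank_of M (insert e F)" using F by (auto simp: flats_def)
    then show ?thesis using sub e by (auto simp: uniform_rankD(2)[OF M])
  qed
  with sub show "F \<in> insert (ground M) {F. F \<subseteq> ground M \<and> card F < d}" by auto
next
  fix F assume F: "F \<in> insert (ground M) {F. F \<subseteq> ground M \<and> card F < d}"
  have "F \<in> flats M" if sub: "F \<subseteq> ground M" and "card F < d"
  proof -
    have "finite F" using sub finite_ground finite_subset by metis
    then show ?thesis using that by (auto simp: flats_def uniform_rankD(2)[OF M])
  qed
  with F show "F \<in> flats M" by auto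
qed

lemma sum_subsets_by_card:
  fixes g :: "nat \<Rightarrow> int"
  assumes "finite E" "finite K"
  shows "(\<Sum>F | F \<subseteq> E \<and> card F \<in> K. g (card F)) = (\<Sum>k\<in>K. int (card E choose k) * g k)"
proof -
  let ?S = "{F. F \<subseteq> E \<and> card F \<in> K}"
  have "finite ?S" using assms by (auto intro: finite_subset[of _ "Pow E"])
  then have "(\<Sum>F\<in>?S. g (card F)) = (\<Sum>k\<in>K. \<Sum>F | F \<in> ?S \<and> card F = k. g (card F))"
    using assms by (intro sum.group[symmetric]) auto
  also have "\<dots> = (\<Sum>k\<in>K. int (card E choose k) * g k)"
  proof (intro sum.cong refl)
    fix k assume "k \<in> K"
    then have "{F. F \<in> ?S \<and> card F = k} = {F. F \<subseteq> E \<and> card F = k}" by auto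
    then show "(\<Sum>F | F \<in> ?S \<and> card F = k. g (card F)) = int (card E choose k) * g k"
      using n_subsets[OF assms(1), of k] by simp
  qed
  finally show ?thesis .
qed

text \<open>The ground set contributes the monomial of degree \<open>d\<close>; the other flats of
  positive rank are the \<open>k\<close>-subsets with \<open>0 < k < d\<close>.\<close>

lemma coeff_Z_tail_uniform:
  assumes M: "uniform_rank M d" and d: "0 < d"
    and IH: "\<And>F i. F \<subseteq> ground M \<Longrightarrow> 0 < card F \<Longrightarrow> card F < d \<Longrightarrow>
      coeff (kl (contraction M F)) i = c (d - card F) i"
  shows "coeff (Z_tail M) j = (if j = d then 1 else 0) +
    (\<Sum>k | 0 < k \<and> k < d \<and> k \<le> j. int (card (ground M) choose k) * c (d - k) (j - k))"
proof -
  let ?E = "ground M"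
  let ?S = "{F. F \<subseteq> ?E \<and> card F \<in> {0<..<d}}"
  have cE: "d \<le> card ?E" using M by (rule uniform_rankD)
  have "{F. F \<in> flats M \<and> 0 < rank_of M F} = insert ?E ?S"
    using d cE by (auto simp: flats_uniform_rank[OF M] uniform_rankD(2)[OF M])
  moreover have "finite ?S" by (rule finite_subset[of _ "Pow ?E"]) auto
  moreover have "?E \<notin> ?S" using cE by auto
  ultimately have "coeff (Z_tail M) j =
      coeff (monom 1 (rank_of M ?E) * kl (contraction M ?E)) j +
      (\<Sum>F\<in>?S. coeff (monom 1 (rank_of M F) * kl (contraction M F)) j)"
    by (simp add: Z_tail_def coeff_sum)
  also have "kl (contraction M ?E) = 1"
    by (simp add: kl_Z_tail rk_contraction) (simp add: rk_def)
  also have "coeff (monom 1 (rank_of M ?E) * 1) j = (if j = d then 1 else 0 :: int)"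
    using uniform_rankD(3)[OF M] by (simp add: rk_def)
  also have "(\<Sum>F\<in>?S. coeff (monom 1 (rank_of M F) * kl (contraction M F)) j) =
      (\<Sum>F\<in>?S. (\<lambda>k. if k \<le> j then c (d - k) (j - k) else 0) (card F))"
    by (intro sum.cong refl) (auto simp: uniform_rankD(2)[OF M] coeff_monom_mult IH)
  also have "\<dots> = (\<Sum>k\<in>{0<..<d}. int (card ?E choose k) * (if k \<le> j then c (d - k) (j - k) else 0))"
    by (rule sum_subsets_by_card) simp_all
  also have "\<dots> = (\<Sum>k | k \<in> {0<..<d} \<and> k \<le> j. int (card ?E choose k) * c (d - k) (j - k))"
    by (subst sum.inter_filter) (auto intro!: sum.cong)
  finally show ?thesis by (simp add: conj_assoc)
qed

text \<open>Contracting a \<open>k\<close>-subset lowers \<open>d\<close> by \<open>k\<close> and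
  keeps \<open>m\<close>, so the induction is on \<open>d\<close> alone. Palindromicity determines
  the coefficients below half the rank, and the tableau counts satisfy the same equations.\<close>

lemma coeff_kl_uniform_rank:
  assumes "uniform_rank M d" "card (ground M) = m + d"
  shows "coeff (kl M) i = uniform_coeff m d i"
  using assms
proof (induction d arbitrary: M i rule: less_induct)
  case (less d)
  note M = less.prems(1) and E = less.prems(2)
  have rk: "rk M = d" using M by (rule uniform_rankD)
  show ?case
  proof (cases "d \<le> 2 * i")
    case True
    \<comment> \<open>At or above half the rank both sides vanish, except for the constant term in
      rank 0.\<close>
    have "coeff (kl M) i = 0" if "0 < i"
    proof (cases "d = 0")
      case False
      with True rk show ?thesis by (simp add: kl_Z_tail coeff_half_palindromic)
    qed (use that rk in \<open>simp add: kl_Z_tail\<close>)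
    moreover have "i = 0 \<Longrightarrow> d = 0" using True by simp
    ultimately show ?thesis
      using True rk uniform_coeff_eq_0[of i d m] by (cases "i = 0") (simp_all add: kl_Z_tail)
  next
    case False
    then have d: "0 < d" by simp
    define c where "c = uniform_coeff m"
    define T where "T j = (\<Sum>k | 0 < k \<and> k < d \<and> k \<le> j. int ((m + d) choose k) * c (d - k) (j - k))" for j
    have IH: "coeff (kl (contraction M F)) i = c (d - card F) i"
      if F: "F \<subseteq> ground M" "0 < card F" "card F < d" for F i
      unfolding c_def
    proof (rule less.IH)
      show "uniform_rank (contraction M F) (d - card F)"
        using M F by (intro uniform_rank_contraction) auto
      show "card (ground (contraction M F)) = m + (d - card F)"
        using F E by (simp add: card_Diff_subset finite_subset[OF F(1)])
    qed (use F in auto)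
    have Z: "coeff (Z_tail M) j = (if j = d then 1 else 0) + T j" for j
      unfolding T_def using coeff_Z_tail_uniform[OF M d IH, of j] E by simp
    have "coeff (kl M) i = coeff (Z_tail M) (d - i) - coeff (Z_tail M) i"
      using False d rk by (simp add: kl_Z_tail coeff_half_palindromic)
    also have "\<dots> = c d i"
    proof (cases "i = 0")
      case True
      \<comment> \<open>In \<open>T d\<close> rank and index are both \<open>d - k\<close>, past
        half the rank; the constant term thus comes from the ground set alone.\<close>
      have "T d = 0" unfolding T_def
        by (intro sum.neutral) (auto simp: c_def intro!: uniform_coeff_eq_0)
      moreover have "T 0 = 0" unfolding T_def by (intro sum.neutral) auto
      ultimately show ?thesis using True d by (simp add: Z c_def)
    next
      case i: False
      \<comment> \<open>\<open>T j\<close> lacks exactly the summand \<open>k = 0\<close>, which is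
        \<open>c d j\<close>.\<close>
      have T: "c d j + T j = (\<Sum>k\<le>j. int ((m + d) choose k) * c (d - k) (j - k))" if "j < d" for j
      proof -
        have "{..j} = insert 0 {k. 0 < k \<and> k < d \<and> k \<le> j}" using that by auto
        then show ?thesis by (simp add: T_def)
      qed
      have "c d i + T i = c d (d - i) + T (d - i)"
        using uniform_coeff_palindromic[of i d m] T[of i] T[of "d - i"] i False
        by (simp add: c_def)
      moreover have "c d (d - i) = 0" unfolding c_def using False by (intro uniform_coeff_eq_0) auto
      moreover have "d - i \<noteq> d" "i \<noteq> d" using i d False by auto
      ultimately show ?thesis by (simp add: Z)
    qed
    finally show ?thesis by (simp add: c_def)
  qed
qed

section \<open>The concrete uniform matroid\<close>

lemma ground_uniform [simp]: "ground (uniform_matroid m d) = {1..m + d}"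
  by (simp add: ground.rep_eq uniform_matroid.rep_eq)

lemma indep_uniform: "indep_sets (uniform_matroid m d) = {X. X \<subseteq> {1..m + d} \<and> card X \<le> d}"
  by (simp add: indep_sets.rep_eq uniform_matroid.rep_eq)

lemma uniform_rank_uniform_matroid: "uniform_rank (uniform_matroid m d) d"
  unfolding uniform_rank_def
proof (intro conjI allI impI)
  fix X assume "X \<subseteq> ground (uniform_matroid m d)"
  then have X: "X \<subseteq> {1..m + d}" by simp
  show "rank_of (uniform_matroid m d) X = min (card X) d"
  proof (rule antisym)
    obtain Y where "Y \<in> indep_sets (uniform_matroid m d)" "Y \<subseteq> X" "card Y = rank_of (uniform_matroid m d) X"
      by (rule rank_witness)
    then show "rank_of (uniform_matroid m d) X \<le> min (card X) d"
      using card_mono[of X Y] finite_subset[OF X] by (auto simp: indep_uniform)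
    obtain Y where "Y \<subseteq> X" "card Y = min (card X) d"
      using obtain_subset_with_card_n[of "min (card X) d" X] by auto
    then show "min (card X) d \<le> rank_of (uniform_matroid m d) X"
      using card_indep_le_rank[of Y "uniform_matroid m d" X] X by (auto simp: indep_uniform)
  qed
qed simp

theorem theorem2:
  fixes m d i :: nat
  shows "coeff (KL_poly (uniform_matroid m d)) i
       = int (num_SkYT (int m + 1) i (int d - 2 * int i + 1))"
  using coeff_kl_uniform_rank[OF uniform_rank_uniform_matroid, of m d m i]
  by (simp add: KL_poly_eq_kl uniform_coeff_def)

end
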